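(* Assume that $A$ is stable (all eigenvalues have negative real part) and that $F\succeq0$ and $G\succeq0$. Then $$\operatorname{dist}\Big(D_n(\mathcal H^* ),\operatorname{Range}\begin{bmatrix}I_n\\0\end{bmatrix}\Big)<1 .$$ In other words, the choice $X_0=0$ satisfies the hypothesis $d<1$ of the convergence theorem for the subspace iteration.
   Context: Let $A\in\mathbb C^{n\times n}$ and let $F,G\in\mathbb C^{n\times n}$ be Hermitian; $M^*$ denotes the conjugate transpose and $\succeq0$ denotes Hermitian positive semidefinite. Let $\mathcal H=\begin{bmatrix}A&-F\\-G&-A^*\end{bmatrix}$. Standing assumption: $\mathcal H$ has exactly $n$ eigenvalues (counted with multiplicity) in the open left half-plane and $n$ in the open right half-plane; in particular it has no purely imaginary eigenvalues. $D_n(\mathcal H^* )$ denotes the $n$-dimensional invariant subspace of $\mathcal H^*$ associated with its eigenvalues of negative real part. For subspaces $\mathfrak S_1,\mathfrak S_2$ of equal dimension, $\operatorname{dist}(\mathfrak S_1,\mathfrak S_2)=\|P_1-P_2\|_2$, where $P_i$ is the orthogonal projector onto $\mathfrak S_i$. *)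

theory Defs
  imports "Jordan_Normal_Form.Schur_Decomposition" "Jordan_Normal_Form.Char_Poly"
begin

text \<open>Complex matrices are JNF matrices of type complex mat with explicit dimensions.\<close>

definition hermitian_mat :: "nat \<Rightarrow> complex mat \<Rightarrow> bool" where
  "hermitian_mat n F \<longleftrightarrow> F \<in> carrier_mat n n \<and> mat_adjoint F = F"

text \<open>Hermitian positive semidefinite: v^* F v \<ge> 0 for all v (real since F is Hermitian).\<close>
definition psd_mat :: "nat \<Rightarrow> complex mat \<Rightarrow> bool" where
  "psd_mat n F \<longleftrightarrow> hermitian_mat n F \<and>
     (\<forall>v \<in> carrier_vec n. Im ((F *\<^sub>v v) \<bullet>c v) = 0 \<and> 0 \<le> Re ((F *\<^sub>v v) \<bullet>c v))"

text \<open>Stable: all eigenvalues have negative real part.\<close>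
definition stable_mat :: "complex mat \<Rightarrow> bool" where
  "stable_mat A \<longleftrightarrow> (\<forall>z. eigenvalue A z \<longrightarrow> Re z < 0)"

text \<open>The Hamiltonian matrix [A, -F; -G, -A^*].\<close>
definition hamiltonian :: "complex mat \<Rightarrow> complex mat \<Rightarrow> complex mat \<Rightarrow> complex mat" where
  "hamiltonian A F G = four_block_mat A (- F) (- G) (- mat_adjoint A)"

text \<open>Number of eigenvalues (with algebraic multiplicity) satisfying P.\<close>
definition num_eigs :: "complex mat \<Rightarrow> (complex \<Rightarrow> bool) \<Rightarrow> nat" where
  "num_eigs M P = (\<Sum>z \<in> {z. eigenvalue M z \<and> P z}. order z (char_poly M))"

text \<open>Generalized eigenvector of the N x N matrix M for eigenvalue z.\<close>
definition gen_eigvec :: "nat \<Rightarrow> complex mat \<Rightarrow> complex \<Rightarrow> complex vec \<Rightarrow> bool" where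
  "gen_eigvec N M z v \<longleftrightarrow> v \<in> carrier_vec N \<and>
     (\<exists>k. ((M - z \<cdot>\<^sub>m 1\<^sub>m N) ^\<^sub>m k) *\<^sub>v v = 0\<^sub>v N)"

text \<open>Invariant subspace of M associated with the eigenvalues satisfying P:
  the span of the corresponding generalized eigenvectors (finite sums).\<close>
definition spectral_subspace :: "nat \<Rightarrow> complex mat \<Rightarrow> (complex \<Rightarrow> bool) \<Rightarrow> complex vec set" where
  "spectral_subspace N M P = {w. \<exists>vs. (\<forall>v \<in> set vs. \<exists>z. P z \<and> gen_eigvec N M z v)
       \<and> w = foldr (+) vs (0\<^sub>v N)}"

text \<open>D_n(M): invariant subspace associated with eigenvalues of negative real part.\<close>
definition D_neg :: "nat \<Rightarrow> complex mat \<Rightarrow> complex vec set" where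
  "D_neg N M = spectral_subspace N M (\<lambda>z. Re z < 0)"

definition mat_range :: "complex mat \<Rightarrow> complex vec set" where
  "mat_range M = {M *\<^sub>v x | x. x \<in> carrier_vec (dim_col M)}"

text \<open>Orthogonal projector onto S in C^N.\<close>
definition is_orth_proj :: "nat \<Rightarrow> complex vec set \<Rightarrow> complex mat \<Rightarrow> bool" where
  "is_orth_proj N S P \<longleftrightarrow> P \<in> carrier_mat N N \<and> P * P = P \<and> mat_adjoint P = P \<and> mat_range P = S"

definition orth_proj :: "nat \<Rightarrow> complex vec set \<Rightarrow> complex mat" where
  "orth_proj N S = (THE P. is_orth_proj N S P)"

definition vec_norm2 :: "complex vec \<Rightarrow> real" where
  "vec_norm2 v = sqrt (\<Sum>i<dim_vec v. (cmod (v $ i))\<^sup>2)"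

text \<open>Spectral (operator 2-) norm.\<close>
definition spec_norm :: "complex mat \<Rightarrow> real" where
  "spec_norm M = Sup {vec_norm2 (M *\<^sub>v v) | v. v \<in> carrier_vec (dim_col M) \<and> vec_norm2 v \<le> 1}"

definition subspace_dist :: "nat \<Rightarrow> complex vec set \<Rightarrow> complex vec set \<Rightarrow> real" where
  "subspace_dist N S1 S2 = spec_norm (orth_proj N S1 - orth_proj N S2)"

text \<open>The 2n x n matrix [I_n; 0].\<close>
definition top_id :: "nat \<Rightarrow> complex mat" where
  "top_id n = mat (2 * n) n (\<lambda>(i, j). if i = j then 1 else 0)"

end

theory Submission
  imports
    Defs
    "Jordan_Normal_Form.Jordan_Normal_Form_Existence"
    "Jordan_Normal_Form.Jordan_Normal_Form_Uniqueness"
begin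

text \<open>
  Put \<open>M = \<H>\<^sup>*\<close>, \<open>D = D\<^sub>n(\<H>\<^sup>*)\<close> and \<open>R = Range [I; 0]\<close>. For orthogonal projectors \<open>P\<close>, \<open>Q\<close>
  one has \<open>(P - Q)\<^sup>2 + (I - P - Q)\<^sup>2 = I\<close>, so \<open>\<parallel>P - Q\<parallel> < 1\<close> as soon as \<open>I - P - Q\<close> is invertible,
  which holds when \<open>D \<inter> R\<^sup>\<bottom> = 0\<close> and \<open>D\<^sup>\<bottom> \<inter> R = 0\<close>.

  With \<open>J = [0, I; -I, 0]\<close> the form \<open>\<omega>(u, w) = \<langle>u, J w\<rangle>\<close> satisfies \<open>\<omega>(M u, w) = -\<omega>(u, M w)\<close>,
  so generalized eigenvectors of \<open>M\<close> for \<open>\<lambda>\<close>, \<open>\<mu>\<close> are \<open>\<omega>\<close>-orthogonal unless \<open>cnj \<lambda> + \<mu> = 0\<close>.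
  Hence \<open>D\<close> and the spectral subspace \<open>E\<close> of the eigenvalues with positive real part are
  \<open>\<omega>\<close>-isotropic, and by the standing assumption \<open>\<complex>\<^sup>2\<^sup>n = D \<oplus> E\<close>.
  If \<open>(0, y) \<in> D\<close>, isotropy gives \<open>\<langle>y, G y\<rangle> = \<omega>((0,y), M (0,y)) = 0\<close>, so \<open>G y = 0\<close> because
  \<open>G \<succeq> 0\<close>; thus \<open>M\<close> maps the subspace \<open>{(0, y) \<in> D}\<close> into itself and acts there as \<open>-A\<close>, so an
  eigenvector in it would give \<open>A\<close> an eigenvalue with positive real part. Hence \<open>D \<inter> R\<^sup>\<bottom> = 0\<close>.
  If \<open>(x, 0) \<perp> D\<close>, write \<open>(0, x) = d + e\<close> with \<open>d \<in> D\<close>, \<open>e \<in> E\<close>; since \<open>J (0, x) = (x, 0)\<close>,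
  the vector \<open>e\<close> is \<open>\<omega>\<close>-orthogonal to \<open>D + E = \<complex>\<^sup>2\<^sup>n\<close>, so \<open>e = 0\<close>, \<open>(0, x) \<in> D\<close>, and \<open>x = 0\<close>
  by the first part. Hence \<open>D\<^sup>\<bottom> \<inter> R = 0\<close>.
\<close>

section \<open>Inner product and adjoint\<close>

definition cinner :: "complex vec \<Rightarrow> complex vec \<Rightarrow> complex" where
  "cinner x y = (\<Sum>i = 0..<dim_vec x. cnj (x $ i) * y $ i)"

lemma cinner_add_left: "x \<in> carrier_vec n \<Longrightarrow> y \<in> carrier_vec n \<Longrightarrow> z \<in> carrier_vec n \<Longrightarrow>
  cinner (x + y) z = cinner x z + cinner y z"
  unfolding cinner_def by (simp add: sum.distrib distrib_right)

lemma cinner_add_right: "x \<in> carrier_vec n \<Longrightarrow> y \<in> carrier_vec n \<Longrightarrow> z \<in> carrier_vec n \<Longrightarrow>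
  cinner x (y + z) = cinner x y + cinner x z"
  unfolding cinner_def by (simp add: sum.distrib distrib_left)

lemma cinner_smult_left: "cinner (c \<cdot>\<^sub>v x) y = cnj c * cinner x y"
  unfolding cinner_def by (simp add: sum_distrib_left mult.assoc)

lemma cinner_smult_right: "x \<in> carrier_vec n \<Longrightarrow> y \<in> carrier_vec n \<Longrightarrow> cinner x (c \<cdot>\<^sub>v y) = c * cinner x y"
  unfolding cinner_def by (simp add: sum_distrib_left algebra_simps)

lemma cinner_diff_left: "x \<in> carrier_vec n \<Longrightarrow> y \<in> carrier_vec n \<Longrightarrow> z \<in> carrier_vec n \<Longrightarrow>
  cinner (x - y) z = cinner x z - cinner y z"
  unfolding cinner_def by (simp add: sum_subtractf algebra_simps)

lemma cinner_diff_right: "x \<in> carrier_vec n \<Longrightarrow> y \<in> carrier_vec n \<Longrightarrow> z \<in> carrier_vec n \<Longrightarrow>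
  cinner x (y - z) = cinner x y - cinner x z"
  unfolding cinner_def by (simp add: sum_subtractf algebra_simps)

lemma cinner_uminus_right: "x \<in> carrier_vec n \<Longrightarrow> z \<in> carrier_vec n \<Longrightarrow> cinner x (- z) = - cinner x z"
  unfolding cinner_def by (simp add: sum_negf)

lemma cinner_zero_left[simp]: "cinner (0\<^sub>v n) y = 0"
  unfolding cinner_def by simp

lemma cinner_zero_right: "x \<in> carrier_vec n \<Longrightarrow> cinner x (0\<^sub>v n) = 0"
  unfolding cinner_def by simp

lemma cinner_self: "cinner x x = of_real (\<Sum>i = 0..<dim_vec x. (cmod (x $ i))\<^sup>2)"
  unfolding cinner_def of_real_sum
  by (rule sum.cong, simp, metis complex_norm_square mult.commute)

lemma Re_cinner_self: "Re (cinner x x) = (\<Sum>i = 0..<dim_vec x. (cmod (x $ i))\<^sup>2)"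
  using cinner_self[of x] by simp

lemma Im_cinner_self: "Im (cinner x x) = 0"
  using cinner_self[of x] by simp

lemma Re_cinner_self_nonneg: "0 \<le> Re (cinner x x)"
  unfolding Re_cinner_self by (auto intro: sum_nonneg)

lemma cinner_self_eq_0: assumes x: "x \<in> carrier_vec n" and e: "cinner x x = 0" shows "x = 0\<^sub>v n"
proof -
  have "(\<Sum>i = 0..<dim_vec x. (cmod (x $ i))\<^sup>2) = 0" using e Re_cinner_self[of x] by simp
  hence "\<forall>i\<in>{0..<dim_vec x}. (cmod (x $ i))\<^sup>2 = 0"
    by (subst (asm) sum_nonneg_eq_0_iff, auto)
  thus ?thesis using x by (intro eq_vecI, auto)
qed

lemma cinner_append:
  assumes a: "a \<in> carrier_vec n1" and c: "c \<in> carrier_vec n1"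
    and b: "b \<in> carrier_vec n2" and d: "d \<in> carrier_vec n2"
  shows "cinner (a @\<^sub>v b) (c @\<^sub>v d) = cinner a c + cinner b d"
proof -
  have "(\<Sum>i = 0..<n1+n2. cnj ((a @\<^sub>v b) $ i) * (c @\<^sub>v d) $ i) =
      (\<Sum>i = 0..<n1. cnj ((a @\<^sub>v b) $ i) * (c @\<^sub>v d) $ i)
      + (\<Sum>i = n1..<n1+n2. cnj ((a @\<^sub>v b) $ i) * (c @\<^sub>v d) $ i)"
    by (rule sum.atLeastLessThan_concat[symmetric], auto)
  also have "(\<Sum>i = 0..<n1. cnj ((a @\<^sub>v b) $ i) * (c @\<^sub>v d) $ i) = cinner a c"
    unfolding cinner_def using a b c d by (intro sum.cong, auto)
  also have "(\<Sum>i = n1..<n1+n2. cnj ((a @\<^sub>v b) $ i) * (c @\<^sub>v d) $ i)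
      = (\<Sum>i = 0..<n2. cnj ((a @\<^sub>v b) $ (i+n1)) * (c @\<^sub>v d) $ (i+n1))"
    by (rule sum.shift_bounds_nat_ivl[of _ 0 n1 n2, simplified add.commute, simplified])
  also have "\<dots> = cinner b d"
    unfolding cinner_def using a b c d by (intro sum.cong, auto)
  finally show ?thesis unfolding cinner_def using a b by simp
qed

lemma adjoint_dim[simp]:
  fixes A :: "complex mat"
  shows "dim_row (mat_adjoint A) = dim_col A" "dim_col (mat_adjoint A) = dim_row A"
  unfolding mat_adjoint_def by auto

lemma adjoint_index[simp]:
  fixes A :: "complex mat"
  shows "i < dim_col A \<Longrightarrow> j < dim_row A \<Longrightarrow> mat_adjoint A $$ (i,j) = cnj (A $$ (j,i))"
  unfolding mat_adjoint_def by (simp add: mat_of_rows_index)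

lemma adjoint_carrier[simp]:
  fixes A :: "complex mat" shows "A \<in> carrier_mat nr nc \<Longrightarrow> mat_adjoint A \<in> carrier_mat nc nr"
  by auto

lemma cinner_adjoint:
  assumes A: "A \<in> carrier_mat nr nc" and x: "x \<in> carrier_vec nr" and y: "y \<in> carrier_vec nc"
  shows "cinner x (A *\<^sub>v y) = cinner (mat_adjoint A *\<^sub>v x) y"
proof -
  have "cinner x (A *\<^sub>v y) = (\<Sum>i = 0..<nr. cnj (x $ i) * (\<Sum>j = 0..<nc. A $$ (i,j) * y $ j))"
    unfolding cinner_def using A x y by (intro sum.cong, auto simp: scalar_prod_def)
  also have "\<dots> = (\<Sum>i = 0..<nr. \<Sum>j = 0..<nc. cnj (x $ i) * A $$ (i,j) * y $ j)"
    by (simp add: sum_distrib_left mult.assoc)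
  also have "\<dots> = (\<Sum>j = 0..<nc. \<Sum>i = 0..<nr. cnj (x $ i) * A $$ (i,j) * y $ j)"
    by (rule sum.swap)
  also have "\<dots> = cinner (mat_adjoint A *\<^sub>v x) y"
    unfolding cinner_def using A x y
    by (intro sum.cong, auto simp: scalar_prod_def sum_distrib_left sum_distrib_right
        mult.commute mult.left_commute)
  finally show ?thesis .
qed

lemma cinner_hermitian:
  assumes "hermitian_mat n F" and "x \<in> carrier_vec n" and "y \<in> carrier_vec n"
  shows "cinner x (F *\<^sub>v y) = cinner (F *\<^sub>v x) y"
  using assms cinner_adjoint[of F n n x y] unfolding hermitian_mat_def by auto

lemma cscalar_prod_eq_cinner:
  "v \<in> carrier_vec n \<Longrightarrow> F \<in> carrier_mat n n \<Longrightarrow> (F *\<^sub>v v) \<bullet>c v = cinner v (F *\<^sub>v v)"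
  unfolding cinner_def scalar_prod_def by (intro sum.cong, auto simp: mult.commute)

lemma adjoint_mult:
  fixes A :: "complex mat"
  shows "A \<in> carrier_mat nr n \<Longrightarrow> B \<in> carrier_mat n nc \<Longrightarrow>
    mat_adjoint (A * B) = mat_adjoint B * mat_adjoint A"
  by (intro eq_matI, auto simp: scalar_prod_def cnj_sum mult.commute)

lemma adjoint_add:
  fixes A :: "complex mat"
  shows "A \<in> carrier_mat nr nc \<Longrightarrow> B \<in> carrier_mat nr nc \<Longrightarrow>
    mat_adjoint (A + B) = mat_adjoint A + mat_adjoint B"
  by (intro eq_matI, auto)

lemma adjoint_uminus: fixes A :: "complex mat" shows "mat_adjoint (- A) = - mat_adjoint A"
  by (intro eq_matI, auto)

lemma adjoint_smult: fixes A :: "complex mat" shows "mat_adjoint (c \<cdot>\<^sub>m A) = cnj c \<cdot>\<^sub>m mat_adjoint A"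
  by (intro eq_matI, auto)

lemma adjoint_four_block:
  fixes A :: "complex mat"
  assumes "A \<in> carrier_mat n1 m1" "B \<in> carrier_mat n1 m2"
    and "C \<in> carrier_mat n2 m1" "D \<in> carrier_mat n2 m2"
  shows "mat_adjoint (four_block_mat A B C D) =
    four_block_mat (mat_adjoint A) (mat_adjoint C) (mat_adjoint B) (mat_adjoint D)"
  using assms by (intro eq_matI, auto)

section \<open>Vector sums and generalized eigenvectors\<close>

lemma smult_zero_vec[simp]: "c \<cdot>\<^sub>v 0\<^sub>v n = (0\<^sub>v n :: complex vec)"
  by (intro eq_vecI, auto)

lemma mult_mat_zero_vec[simp]: "A \<in> carrier_mat nr n \<Longrightarrow> A *\<^sub>v 0\<^sub>v n = (0\<^sub>v nr :: complex vec)"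
  by (intro eq_vecI, auto)

lemma vec_diff_eq_0_imp_eq:
  assumes "(a :: complex vec) \<in> carrier_vec N" "b \<in> carrier_vec N" "a - b = 0\<^sub>v N"
  shows "a = b"
proof (rule eq_vecI)
  fix i assume "i < dim_vec b"
  thus "a $ i = b $ i" using assms(1,2) arg_cong[OF assms(3), of "\<lambda>v. v $ i"] by simp
qed (use assms in simp)

lemma add_vec_eq_right_imp_zero:
  assumes "(x :: complex vec) \<in> carrier_vec N" "y \<in> carrier_vec N" "x + y = y"
  shows "x = 0\<^sub>v N"
proof (rule eq_vecI)
  fix i assume "i < dim_vec (0\<^sub>v N :: complex vec)"
  thus "x $ i = 0\<^sub>v N $ i" using assms(1,2) arg_cong[OF assms(3), of "\<lambda>v. v $ i"] by simp
qed (use assms in simp)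

lemma diff_diff_vec_eq_zero_imp_eq:
  assumes "x - y - z = 0\<^sub>v N"
    and "(x :: complex vec) \<in> carrier_vec N" "y \<in> carrier_vec N" "z \<in> carrier_vec N"
  shows "x = y + z"
proof (rule eq_vecI)
  fix i assume "i < dim_vec (y + z)"
  thus "x $ i = (y + z) $ i" using assms(2-4) arg_cong[OF assms(1), of "\<lambda>v. v $ i"]
    by (simp add: diff_eq_eq add.commute)
qed (use assms in simp)

lemma smult_one_mat_mult_vec: "x \<in> carrier_vec N \<Longrightarrow> (c \<cdot>\<^sub>m 1\<^sub>m N) *\<^sub>v (x :: complex vec) = c \<cdot>\<^sub>v x"
  by (intro eq_vecI, auto simp: scalar_prod_def if_distrib if_distribR cong: if_cong)

lemma shift_carrier[simp]: "M \<in> carrier_mat N N \<Longrightarrow> M - c \<cdot>\<^sub>m 1\<^sub>m N \<in> carrier_mat N N"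
  by auto

lemma shift_mult_vec_carrier[simp]:
  "M \<in> carrier_mat N N \<Longrightarrow> x \<in> carrier_vec N \<Longrightarrow> (M - c \<cdot>\<^sub>m 1\<^sub>m N) *\<^sub>v x \<in> carrier_vec N"
  by (rule mult_mat_vec_carrier[of _ N N], auto)

lemma shift_mult_vec:
  assumes "M \<in> carrier_mat N N" and "x \<in> carrier_vec N"
  shows "(M - c \<cdot>\<^sub>m 1\<^sub>m N) *\<^sub>v x = M *\<^sub>v x - c \<cdot>\<^sub>v (x :: complex vec)"
  using assms by (simp add: minus_mult_distrib_mat_vec[of _ N N] smult_one_mat_mult_vec)

lemma vsum_carrier:
  "set (vs :: complex vec list) \<subseteq> carrier_vec N \<Longrightarrow> foldr (+) vs (0\<^sub>v N) \<in> carrier_vec N"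
  by (induct vs, auto)

lemma vsum_append:
  "set (vs :: complex vec list) \<subseteq> carrier_vec N \<Longrightarrow> set ws \<subseteq> carrier_vec N \<Longrightarrow>
    foldr (+) (vs @ ws) (0\<^sub>v N) = foldr (+) vs (0\<^sub>v N) + foldr (+) ws (0\<^sub>v N)"
proof (induct vs)
  case Nil
  then show ?case using vsum_carrier[of ws N] by auto
next
  case (Cons v vs)
  then show ?case using vsum_carrier[of ws N] vsum_carrier[of vs N]
    by (simp add: assoc_add_vec[symmetric, of v N])
qed

lemma vsum_mult:
  "(A :: complex mat) \<in> carrier_mat m N \<Longrightarrow> set vs \<subseteq> carrier_vec N \<Longrightarrow>
    A *\<^sub>v foldr (+) vs (0\<^sub>v N) = foldr (+) (map ((*\<^sub>v) A) vs) (0\<^sub>v m)"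
proof (induct vs)
  case (Cons v vs)
  then show ?case using vsum_carrier[of vs N] by (auto simp: mult_add_distrib_mat_vec)
qed auto

lemma vsum_smult:
  "set (vs :: complex vec list) \<subseteq> carrier_vec N \<Longrightarrow>
    c \<cdot>\<^sub>v foldr (+) vs (0\<^sub>v N) = foldr (+) (map (\<lambda>v. c \<cdot>\<^sub>v v) vs) (0\<^sub>v N)"
proof (induct vs)
  case (Cons v vs)
  then show ?case using vsum_carrier[of vs N] by (auto simp: smult_add_distrib_vec)
qed auto

lemma vsum_zeros: "\<forall>v\<in>set vs. v = (0\<^sub>v N :: complex vec) \<Longrightarrow> foldr (+) vs (0\<^sub>v N) = 0\<^sub>v N"
  by (induct vs, auto)

lemma vsum_filter_split:
  fixes f :: "'b \<Rightarrow> complex vec"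
  assumes "\<And>i. i \<in> set xs \<Longrightarrow> f i \<in> carrier_vec N"
  shows "foldr (+) (map f xs) (0\<^sub>v N)
    = foldr (+) (map f (filter p xs)) (0\<^sub>v N) + foldr (+) (map f (filter (\<lambda>i. \<not> p i) xs)) (0\<^sub>v N)"
  using assms
proof (induct xs)
  case (Cons x xs)
  let ?S1 = "foldr (+) (map f (filter p xs)) (0\<^sub>v N)"
  let ?S2 = "foldr (+) (map f (filter (\<lambda>i. \<not> p i) xs)) (0\<^sub>v N)"
  have c1: "?S1 \<in> carrier_vec N" and c2: "?S2 \<in> carrier_vec N" and fx: "f x \<in> carrier_vec N"
    using Cons(2) by (auto intro!: vsum_carrier)
  have IH: "foldr (+) (map f xs) (0\<^sub>v N) = ?S1 + ?S2" using Cons by simp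
  have assoc: "f x + (?S1 + ?S2) = (f x + ?S1) + ?S2" using fx c1 c2 by (rule assoc_add_vec[symmetric])
  show ?case
  proof (cases "p x")
    case True
    then show ?thesis using IH assoc by simp
  next
    case False
    have "f x + (?S1 + ?S2) = ?S1 + (f x + ?S2)"
      unfolding assoc comm_add_vec[OF fx c1] using c1 fx c2 by (rule assoc_add_vec)
    then show ?thesis using IH False by simp
  qed
qed simp

lemma vsum_index:
  "set (vs :: complex vec list) \<subseteq> carrier_vec N \<Longrightarrow> j < N \<Longrightarrow>
    (foldr (+) vs (0\<^sub>v N)) $ j = sum_list (map (\<lambda>v. v $ j) vs)"
proof (induct vs)
  case (Cons v vs)
  then show ?case using vsum_carrier[of vs N] by auto
qed auto

lemma mult_vec_eq_vsum_cols:
  assumes P: "(P :: complex mat) \<in> carrier_mat N N" and w: "w \<in> carrier_vec N"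
  shows "P *\<^sub>v w = foldr (+) (map (\<lambda>i. w $ i \<cdot>\<^sub>v col P i) [0..<N]) (0\<^sub>v N)"
proof (rule eq_vecI)
  let ?S = "foldr (+) (map (\<lambda>i. w $ i \<cdot>\<^sub>v col P i) [0..<N]) (0\<^sub>v N)"
  have c: "set (map (\<lambda>i. w $ i \<cdot>\<^sub>v col P i) [0..<N]) \<subseteq> carrier_vec N" using P by auto
  show "dim_vec (P *\<^sub>v w) = dim_vec ?S" using vsum_carrier[OF c] P by auto
  fix j assume "j < dim_vec ?S"
  hence j: "j < N" using vsum_carrier[OF c] by auto
  have "?S $ j = sum_list (map (\<lambda>i. w $ i * P $$ (j, i)) [0..<N])"
    unfolding vsum_index[OF c j] map_map o_def using j P by (intro arg_cong[of _ _ sum_list], auto)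
  also have "\<dots> = (\<Sum>i = 0..<N. w $ i * P $$ (j, i))"
    by (subst sum_list_distinct_conv_sum_set, auto)
  also have "\<dots> = (P *\<^sub>v w) $ j" using P w j by (auto simp: scalar_prod_def mult.commute)
  finally show "(P *\<^sub>v w) $ j = ?S $ j" by (rule sym)
qed

definition commute_mat :: "nat \<Rightarrow> 'a :: comm_ring_1 mat \<Rightarrow> 'a mat \<Rightarrow> bool" where
  "commute_mat N X Y \<longleftrightarrow> X \<in> carrier_mat N N \<and> Y \<in> carrier_mat N N \<and> X * Y = Y * X"

lemma commute_mat_sym: "commute_mat N X Y \<Longrightarrow> commute_mat N Y X"
  unfolding commute_mat_def by auto

lemma commute_mat_refl: "X \<in> carrier_mat N N \<Longrightarrow> commute_mat N X X"
  unfolding commute_mat_def by auto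

lemma commute_mat_mult:
  assumes "commute_mat N X Y" "commute_mat N X Z"
  shows "commute_mat N X (Y * Z)"
proof -
  from assms have X: "X \<in> carrier_mat N N" and Y: "Y \<in> carrier_mat N N" and Z: "Z \<in> carrier_mat N N"
    and XY: "X * Y = Y * X" and XZ: "X * Z = Z * X" unfolding commute_mat_def by auto
  have "X * (Y * Z) = (X * Y) * Z" using X Y Z by (simp add: assoc_mult_mat)
  also have "\<dots> = Y * (X * Z)" unfolding XY using X Y Z by (simp add: assoc_mult_mat)
  also have "\<dots> = (Y * Z) * X" unfolding XZ using X Y Z by (simp add: assoc_mult_mat)
  finally show ?thesis using X Y Z unfolding commute_mat_def by auto
qed

lemma commute_mat_shift:
  assumes "commute_mat N X Y"
  shows "commute_mat N X (Y - c \<cdot>\<^sub>m 1\<^sub>m N)"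
proof -
  from assms have X: "X \<in> carrier_mat N N" and Y: "Y \<in> carrier_mat N N"
    and XY: "X * Y = Y * X" unfolding commute_mat_def by auto
  have "X * (Y - c \<cdot>\<^sub>m 1\<^sub>m N) = X * Y - c \<cdot>\<^sub>m X" using X Y
    by (simp add: mult_minus_distrib_mat[of _ N N _ N] mult_smult_distrib[of _ N N _ N])
  also have "\<dots> = Y * X - c \<cdot>\<^sub>m X" unfolding XY ..
  also have "\<dots> = (Y - c \<cdot>\<^sub>m 1\<^sub>m N) * X" using X Y
    by (simp add: minus_mult_distrib_mat[of _ N N _ _ N] mult_smult_assoc_mat[of _ N N _ N])
  finally show ?thesis using X Y unfolding commute_mat_def by auto
qed

lemma commute_mat_pow:
  assumes "commute_mat N X Y"
  shows "commute_mat N X (Y ^\<^sub>m k)"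
proof (induct k)
  case 0
  then show ?case using assms unfolding commute_mat_def by auto
next
  case (Suc k)
  then show ?case using commute_mat_mult[OF Suc assms] by simp
qed

context
  fixes N :: nat and M :: "complex mat"
  assumes M: "M \<in> carrier_mat N N"
begin

lemma gen_eigvec_carrier: "gen_eigvec N M z v \<Longrightarrow> v \<in> carrier_vec N"
  unfolding gen_eigvec_def by auto

lemma gen_eigvec_smult:
  assumes "gen_eigvec N M z v"
  shows "gen_eigvec N M z (c \<cdot>\<^sub>v v)"
proof -
  from assms obtain k where v: "v \<in> carrier_vec N" and k: "((M - z \<cdot>\<^sub>m 1\<^sub>m N) ^\<^sub>m k) *\<^sub>v v = 0\<^sub>v N"
    unfolding gen_eigvec_def by auto
  have "((M - z \<cdot>\<^sub>m 1\<^sub>m N) ^\<^sub>m k) *\<^sub>v (c \<cdot>\<^sub>v v) = c \<cdot>\<^sub>v (((M - z \<cdot>\<^sub>m 1\<^sub>m N) ^\<^sub>m k) *\<^sub>v v)"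
    using M v by (intro mult_mat_vec[of _ N N], auto)
  thus ?thesis unfolding gen_eigvec_def using k v by auto
qed

lemma gen_eigvec_mult:
  assumes "gen_eigvec N M z v"
  shows "gen_eigvec N M z (M *\<^sub>v v)"
proof -
  from assms obtain k where v: "v \<in> carrier_vec N" and k: "((M - z \<cdot>\<^sub>m 1\<^sub>m N) ^\<^sub>m k) *\<^sub>v v = 0\<^sub>v N"
    unfolding gen_eigvec_def by auto
  let ?T = "(M - z \<cdot>\<^sub>m 1\<^sub>m N) ^\<^sub>m k"
  have c: "commute_mat N M ?T"
    by (rule commute_mat_pow, rule commute_mat_shift, rule commute_mat_refl[OF M])
  hence T: "?T \<in> carrier_mat N N" unfolding commute_mat_def by auto
  have "?T *\<^sub>v (M *\<^sub>v v) = (?T * M) *\<^sub>v v" by (rule assoc_mult_mat_vec[OF T M v, symmetric])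
  also have "\<dots> = (M * ?T) *\<^sub>v v" using c unfolding commute_mat_def by auto
  also have "\<dots> = 0\<^sub>v N" unfolding assoc_mult_mat_vec[OF M T v] k using M by simp
  finally show ?thesis unfolding gen_eigvec_def using v M by auto
qed

lemma spectral_subspace_carrier: "x \<in> spectral_subspace N M P \<Longrightarrow> x \<in> carrier_vec N"
  unfolding spectral_subspace_def using gen_eigvec_carrier by (auto intro!: vsum_carrier)

lemma spectral_subspace_zero: "0\<^sub>v N \<in> spectral_subspace N M P"
  unfolding spectral_subspace_def by (auto intro: exI[of _ "[]"])

lemma spectral_subspace_gen_eigvec: "P z \<Longrightarrow> gen_eigvec N M z v \<Longrightarrow> v \<in> spectral_subspace N M P"
  unfolding spectral_subspace_def using gen_eigvec_carrier by (auto intro!: exI[of _ "[v]"])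

lemma spectral_subspace_add:
  assumes "x \<in> spectral_subspace N M P" "y \<in> spectral_subspace N M P"
  shows "x + y \<in> spectral_subspace N M P"
proof -
  from assms obtain vs ws
    where vs: "\<forall>v \<in> set vs. \<exists>z. P z \<and> gen_eigvec N M z v" "x = foldr (+) vs (0\<^sub>v N)"
      and ws: "\<forall>v \<in> set ws. \<exists>z. P z \<and> gen_eigvec N M z v" "y = foldr (+) ws (0\<^sub>v N)"
    unfolding spectral_subspace_def by auto
  have "set vs \<subseteq> carrier_vec N" "set ws \<subseteq> carrier_vec N" using vs ws gen_eigvec_carrier by auto
  from vsum_append[OF this] vs ws show ?thesis
    unfolding spectral_subspace_def by (intro CollectI exI[of _ "vs @ ws"], auto)
qed

lemma spectral_subspace_smult:
  assumes "x \<in> spectral_subspace N M P"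
  shows "c \<cdot>\<^sub>v x \<in> spectral_subspace N M P"
proof -
  from assms obtain vs where vs: "\<forall>v \<in> set vs. \<exists>z. P z \<and> gen_eigvec N M z v" "x = foldr (+) vs (0\<^sub>v N)"
    unfolding spectral_subspace_def by auto
  have "set vs \<subseteq> carrier_vec N" using vs gen_eigvec_carrier by auto
  from vsum_smult[OF this] vs gen_eigvec_smult show ?thesis
    unfolding spectral_subspace_def by (intro CollectI exI[of _ "map (\<lambda>v. c \<cdot>\<^sub>v v) vs"], auto, blast)
qed

lemma spectral_subspace_mult:
  assumes "x \<in> spectral_subspace N M P"
  shows "M *\<^sub>v x \<in> spectral_subspace N M P"
proof -
  from assms obtain vs where vs: "\<forall>v \<in> set vs. \<exists>z. P z \<and> gen_eigvec N M z v" "x = foldr (+) vs (0\<^sub>v N)"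
    unfolding spectral_subspace_def by auto
  have "set vs \<subseteq> carrier_vec N" using vs gen_eigvec_carrier by auto
  from vsum_mult[OF M this] vs gen_eigvec_mult show ?thesis
    unfolding spectral_subspace_def by (intro CollectI exI[of _ "map ((*\<^sub>v) M) vs"], auto, blast)
qed

lemma spectral_subspace_diff:
  assumes "x \<in> spectral_subspace N M P" "y \<in> spectral_subspace N M P"
  shows "x - y \<in> spectral_subspace N M P"
proof -
  have "x - y = x + (-1) \<cdot>\<^sub>v y"
    using spectral_subspace_carrier[OF assms(1)] spectral_subspace_carrier[OF assms(2)] by auto
  thus ?thesis using spectral_subspace_add[OF assms(1) spectral_subspace_smult[OF assms(2)]] by simp
qed

lemma spectral_subspace_shift:
  assumes "x \<in> spectral_subspace N M P"
  shows "(M - c \<cdot>\<^sub>m 1\<^sub>m N) *\<^sub>v x \<in> spectral_subspace N M P"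
  unfolding shift_mult_vec[OF M spectral_subspace_carrier[OF assms]]
  by (intro spectral_subspace_diff spectral_subspace_mult spectral_subspace_smult assms)

lemma spectral_subspace_vsum:
  "set vs \<subseteq> spectral_subspace N M P \<Longrightarrow> foldr (+) vs (0\<^sub>v N) \<in> spectral_subspace N M P"
  by (induct vs) (auto intro: spectral_subspace_zero spectral_subspace_add)

end

section \<open>Annihilating products of shifts\<close>

definition shift_prod :: "nat \<Rightarrow> complex mat \<Rightarrow> complex list \<Rightarrow> complex mat" where
  "shift_prod N M cs = foldr (\<lambda>c X. (M - c \<cdot>\<^sub>m 1\<^sub>m N) * X) cs (1\<^sub>m N)"

lemma shift_prod_Nil[simp]: "shift_prod N M [] = 1\<^sub>m N"
  unfolding shift_prod_def by simp

lemma shift_prod_Cons[simp]: "shift_prod N M (c # cs) = (M - c \<cdot>\<^sub>m 1\<^sub>m N) * shift_prod N M cs"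
  unfolding shift_prod_def by simp

context
  fixes N :: nat and M :: "complex mat"
  assumes M: "M \<in> carrier_mat N N"
begin

lemma shift_prod_carrier[simp]: "shift_prod N M cs \<in> carrier_mat N N"
  by (induct cs) (use M in auto)

lemma commute_mat_shift_prod: "commute_mat N Y M \<Longrightarrow> commute_mat N Y (shift_prod N M cs)"
proof (induct cs)
  case Nil
  then show ?case unfolding commute_mat_def
    by (metis left_mult_one_mat right_mult_one_mat one_carrier_mat shift_prod_Nil)
next
  case (Cons c cs)
  then show ?case by (simp add: commute_mat_mult commute_mat_shift)
qed

lemma shift_prod_replicate: "shift_prod N M (replicate k z) = (M - z \<cdot>\<^sub>m 1\<^sub>m N) ^\<^sub>m k"
proof (induct k)
  case (Suc k)
  let ?T = "M - z \<cdot>\<^sub>m 1\<^sub>m N"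
  have "commute_mat N ?T (?T ^\<^sub>m k)" by (rule commute_mat_pow, rule commute_mat_refl) (use M in auto)
  thus ?case using Suc by (simp add: commute_mat_def)
qed simp

lemma shift_prod_append: "shift_prod N M (cs @ ds) = shift_prod N M cs * shift_prod N M ds"
proof (induct cs)
  case Nil
  then show ?case using left_mult_one_mat[OF shift_prod_carrier[of ds]] by simp
next
  case (Cons c cs)
  then show ?case using M shift_prod_carrier[of cs] shift_prod_carrier[of ds]
    by (simp, intro assoc_mult_mat[symmetric, of _ N N _ N _ N], auto)
qed

lemma shift_prod_annihilates:
  "\<forall>v\<in>set vs. \<exists>z. P z \<and> gen_eigvec N M z v \<Longrightarrow>
    \<exists>cs. (\<forall>c\<in>set cs. P c) \<and> (\<forall>v\<in>set vs. shift_prod N M cs *\<^sub>v v = 0\<^sub>v N)"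
proof (induct vs)
  case Nil
  then show ?case by (intro exI[of _ "[]"], auto)
next
  case (Cons v vs)
  then obtain cs where cs: "\<forall>c\<in>set cs. P c" "\<forall>u\<in>set vs. shift_prod N M cs *\<^sub>v u = 0\<^sub>v N" by auto
  from Cons obtain z k where z: "P z" and v: "v \<in> carrier_vec N"
    and k: "((M - z \<cdot>\<^sub>m 1\<^sub>m N) ^\<^sub>m k) *\<^sub>v v = 0\<^sub>v N" unfolding gen_eigvec_def by auto
  let ?T = "(M - z \<cdot>\<^sub>m 1\<^sub>m N) ^\<^sub>m k"
  let ?Q = "shift_prod N M cs"
  have T: "?T \<in> carrier_mat N N" using M by auto
  have "commute_mat N ?T M"
    by (rule commute_mat_sym, rule commute_mat_pow, rule commute_mat_shift, rule commute_mat_refl[OF M])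
  hence TQ: "?T * ?Q = ?Q * ?T" using commute_mat_shift_prod unfolding commute_mat_def by auto
  have op: "shift_prod N M (replicate k z @ cs) = ?T * ?Q"
    by (simp add: shift_prod_append shift_prod_replicate)
  have "shift_prod N M (replicate k z @ cs) *\<^sub>v u = 0\<^sub>v N" if u: "u \<in> set (v # vs)" for u
  proof (cases "u = v")
    case True
    have "shift_prod N M (replicate k z @ cs) *\<^sub>v u = ?Q *\<^sub>v (?T *\<^sub>v v)"
      unfolding op TQ True using T v by (simp add: assoc_mult_mat_vec[of _ N N _ N])
    thus ?thesis using k by simp
  next
    case False
    with u have "u \<in> carrier_vec N" "?Q *\<^sub>v u = 0\<^sub>v N"
      using Cons(2) cs(2) unfolding gen_eigvec_def by auto
    thus ?thesis unfolding op using T by (simp add: assoc_mult_mat_vec[of _ N N _ N])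
  qed
  thus ?case using z cs by (intro exI[of _ "replicate k z @ cs"]) auto
qed

lemma spectral_subspace_annihilated:
  assumes "x \<in> spectral_subspace N M P"
  shows "\<exists>cs. (\<forall>c\<in>set cs. P c) \<and> shift_prod N M cs *\<^sub>v x = 0\<^sub>v N"
proof -
  from assms obtain vs where vs: "\<forall>v \<in> set vs. \<exists>z. P z \<and> gen_eigvec N M z v" "x = foldr (+) vs (0\<^sub>v N)"
    unfolding spectral_subspace_def by auto
  have c: "set vs \<subseteq> carrier_vec N" using vs unfolding gen_eigvec_def by auto
  from shift_prod_annihilates[OF vs(1)] obtain cs
    where cs: "\<forall>c\<in>set cs. P c" "\<forall>v\<in>set vs. shift_prod N M cs *\<^sub>v v = 0\<^sub>v N" by auto
  have "shift_prod N M cs *\<^sub>v x = foldr (+) (map ((*\<^sub>v) (shift_prod N M cs)) vs) (0\<^sub>v N)"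
    unfolding vs(2) by (rule vsum_mult[OF shift_prod_carrier c])
  also have "\<dots> = 0\<^sub>v N" by (rule vsum_zeros) (use cs in auto)
  finally show ?thesis using cs by auto
qed

context
  fixes K :: "complex vec set"
  assumes K: "K \<subseteq> carrier_vec N"
    and K_shift: "\<And>c x. x \<in> K \<Longrightarrow> (M - c \<cdot>\<^sub>m 1\<^sub>m N) *\<^sub>v x \<in> K"
begin

lemma shift_prod_invariant: "d \<in> K \<Longrightarrow> shift_prod N M cs *\<^sub>v d \<in> K"
proof (induct cs)
  case (Cons c cs)
  have "shift_prod N M (c # cs) *\<^sub>v d = (M - c \<cdot>\<^sub>m 1\<^sub>m N) *\<^sub>v (shift_prod N M cs *\<^sub>v d)"
    unfolding shift_prod_Cons using M Cons(2) K shift_prod_carrier[of cs]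
    by (intro assoc_mult_mat_vec[of _ N N _ N], auto)
  then show ?case using K_shift[OF Cons(1)[OF Cons(2)]] by simp
qed (use K in auto)

lemma invariant_subspace_eigenvector:
  assumes d: "d \<in> K" and d0: "d \<noteq> 0\<^sub>v N"
  shows "shift_prod N M cs *\<^sub>v d = 0\<^sub>v N \<Longrightarrow> \<exists>c\<in>set cs. \<exists>w\<in>K. w \<noteq> 0\<^sub>v N \<and> M *\<^sub>v w = c \<cdot>\<^sub>v w"
proof (induct cs)
  case Nil
  then show ?case using d d0 K by auto
next
  case (Cons c cs)
  let ?w = "shift_prod N M cs *\<^sub>v d"
  have wK: "?w \<in> K" by (rule shift_prod_invariant[OF d])
  hence w: "?w \<in> carrier_vec N" using K by auto
  show ?case
  proof (cases "?w = 0\<^sub>v N")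
    case True
    then show ?thesis using Cons by auto
  next
    case False
    have "(M - c \<cdot>\<^sub>m 1\<^sub>m N) *\<^sub>v ?w = 0\<^sub>v N" using Cons(2) M d K shift_prod_carrier[of cs]
      unfolding shift_prod_Cons by (subst (asm) assoc_mult_mat_vec[of _ N N _ N], auto)
    hence "M *\<^sub>v ?w = c \<cdot>\<^sub>v ?w"
      unfolding shift_mult_vec[OF M w] by (rule vec_diff_eq_0_imp_eq[rotated 2]) (use M w in auto)
    thus ?thesis using False wK by auto
  qed
qed

end

lemma gen_eigvec_eigenvalue:
  assumes g: "gen_eigvec N M z v" and v0: "v \<noteq> 0\<^sub>v N"
  shows "eigenvalue M z"
proof -
  from g obtain k where v: "v \<in> carrier_vec N" and k: "((M - z \<cdot>\<^sub>m 1\<^sub>m N) ^\<^sub>m k) *\<^sub>v v = 0\<^sub>v N"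
    unfolding gen_eigvec_def by auto
  have kill: "shift_prod N M (replicate k z) *\<^sub>v v = 0\<^sub>v N" unfolding shift_prod_replicate using k .
  have "\<exists>c\<in>set (replicate k z). \<exists>w\<in>carrier_vec N. w \<noteq> 0\<^sub>v N \<and> M *\<^sub>v w = c \<cdot>\<^sub>v w"
    by (rule invariant_subspace_eigenvector[of "carrier_vec N", OF _ _ v v0 kill]) (use M in auto)
  then obtain w where "w \<in> carrier_vec N" "w \<noteq> 0\<^sub>v N" "M *\<^sub>v w = z \<cdot>\<^sub>v w" by auto
  thus ?thesis unfolding eigenvalue_def eigenvector_def using M by (intro exI[of _ w], auto)
qed

lemma shift_prod_eigenvector:
  assumes w: "w \<in> carrier_vec N" and Mw: "M *\<^sub>v w = c \<cdot>\<^sub>v w"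
  shows "shift_prod N M cs *\<^sub>v w = (\<Prod>x\<leftarrow>cs. (c - x)) \<cdot>\<^sub>v w"
proof (induct cs)
  case Nil
  then show ?case using w by auto
next
  case (Cons x cs)
  have "shift_prod N M (x # cs) *\<^sub>v w = (M - x \<cdot>\<^sub>m 1\<^sub>m N) *\<^sub>v ((\<Prod>x\<leftarrow>cs. (c - x)) \<cdot>\<^sub>v w)"
    using M w Cons shift_prod_carrier[of cs] unfolding shift_prod_Cons
    by (subst assoc_mult_mat_vec[of _ N N _ N], auto)
  also have "\<dots> = (\<Prod>x\<leftarrow>cs. (c - x)) \<cdot>\<^sub>v ((M - x \<cdot>\<^sub>m 1\<^sub>m N) *\<^sub>v w)"
    using M w by (intro mult_mat_vec[of _ N N], auto)
  also have "(M - x \<cdot>\<^sub>m 1\<^sub>m N) *\<^sub>v w = (c - x) \<cdot>\<^sub>v w" unfolding shift_mult_vec[OF M w] Mw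
    using w by (intro eq_vecI, auto simp: algebra_simps)
  finally show ?case by (simp add: smult_smult_assoc mult.commute)
qed

lemma spectral_subspaces_disjoint:
  assumes xn: "x \<in> spectral_subspace N M Pn" and xp: "x \<in> spectral_subspace N M Pp"
    and disj: "\<And>z. Pn z \<Longrightarrow> Pp z \<Longrightarrow> False"
  shows "x = 0\<^sub>v N"
proof (rule ccontr)
  assume x0: "x \<noteq> 0\<^sub>v N"
  from spectral_subspace_annihilated[OF xn] obtain cs
    where cs: "\<forall>c\<in>set cs. Pn c" "shift_prod N M cs *\<^sub>v x = 0\<^sub>v N" by auto
  have "\<exists>c\<in>set cs. \<exists>w\<in>spectral_subspace N M Pp. w \<noteq> 0\<^sub>v N \<and> M *\<^sub>v w = c \<cdot>\<^sub>v w"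
    by (rule invariant_subspace_eigenvector[OF _ _ xp x0 cs(2)])
      (use spectral_subspace_carrier[OF M] spectral_subspace_shift[OF M] in auto)
  then obtain c w where c: "Pn c" and wK: "w \<in> spectral_subspace N M Pp" and w0: "w \<noteq> 0\<^sub>v N"
    and Mw: "M *\<^sub>v w = c \<cdot>\<^sub>v w" using cs by auto
  have wc: "w \<in> carrier_vec N" using spectral_subspace_carrier[OF M wK] .
  from spectral_subspace_annihilated[OF wK] obtain ds
    where ds: "\<forall>d\<in>set ds. Pp d" "shift_prod N M ds *\<^sub>v w = 0\<^sub>v N" by auto
  have e: "(\<Prod>x\<leftarrow>ds. (c - x)) \<cdot>\<^sub>v w = 0\<^sub>v N" using ds(2) shift_prod_eigenvector[OF wc Mw] by simp
  have nz: "(\<Prod>x\<leftarrow>ds. (c - x)) \<noteq> 0" using ds(1) disj c by (auto simp: prod_list_zero_iff, blast)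
  have "w = 0\<^sub>v N"
  proof (rule eq_vecI)
    fix i assume "i < dim_vec (0\<^sub>v N :: complex vec)"
    hence i: "i < N" by simp
    have "((\<Prod>x\<leftarrow>ds. (c - x)) \<cdot>\<^sub>v w) $ i = 0" unfolding e using i by simp
    thus "w $ i = 0\<^sub>v N $ i" using nz i wc by simp
  qed (use wc in auto)
  thus False using w0 by auto
qed

end

section \<open>A basis of generalized eigenvectors\<close>

lemma four_block_diag_shift:
  assumes X: "(X :: complex mat) \<in> carrier_mat m m" and Y: "Y \<in> carrier_mat r r"
  shows "four_block_mat X (0\<^sub>m m r) (0\<^sub>m r m) Y - z \<cdot>\<^sub>m 1\<^sub>m (m+r) =
    four_block_mat (X - z \<cdot>\<^sub>m 1\<^sub>m m) (0\<^sub>m m r) (0\<^sub>m r m) (Y - z \<cdot>\<^sub>m 1\<^sub>m r)"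
  using X Y by (intro eq_matI, auto simp: index_mat_four_block)

lemma four_block_diag_pow_mult_vec:
  assumes X: "(X :: complex mat) \<in> carrier_mat m m" and Y: "Y \<in> carrier_mat r r"
  shows "a \<in> carrier_vec m \<Longrightarrow> b \<in> carrier_vec r \<Longrightarrow>
    (four_block_mat X (0\<^sub>m m r) (0\<^sub>m r m) Y ^\<^sub>m k) *\<^sub>v (a @\<^sub>v b) = (X ^\<^sub>m k *\<^sub>v a) @\<^sub>v (Y ^\<^sub>m k *\<^sub>v b)"
proof (induct k arbitrary: a b)
  case 0
  then show ?case using X Y by (simp add: one_mult_mat_vec)
next
  case (Suc k)
  let ?B = "four_block_mat X (0\<^sub>m m r) (0\<^sub>m r m) Y"
  have B: "?B \<in> carrier_mat (m+r) (m+r)" using X Y by auto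
  have ab: "a @\<^sub>v b \<in> carrier_vec (m+r)" using Suc by auto
  have "(?B ^\<^sub>m Suc k) *\<^sub>v (a @\<^sub>v b) = (?B ^\<^sub>m k) *\<^sub>v (?B *\<^sub>v (a @\<^sub>v b))"
    using B ab by (simp add: assoc_mult_mat_vec[of _ "m+r" "m+r" _ "m+r"])
  also have "?B *\<^sub>v (a @\<^sub>v b) = (X *\<^sub>v a) @\<^sub>v (Y *\<^sub>v b)"
    by (rule mult_mat_vec_split[OF X Y Suc(2) Suc(3)])
  also have "(?B ^\<^sub>m k) *\<^sub>v \<dots> = (X ^\<^sub>m k *\<^sub>v (X *\<^sub>v a)) @\<^sub>v (Y ^\<^sub>m k *\<^sub>v (Y *\<^sub>v b))"
    by (rule Suc(1)) (use X Y Suc in auto)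
  also have "X ^\<^sub>m k *\<^sub>v (X *\<^sub>v a) = X ^\<^sub>m Suc k *\<^sub>v a" using X Suc
    by (simp add: assoc_mult_mat_vec[of _ m m _ m])
  also have "Y ^\<^sub>m k *\<^sub>v (Y *\<^sub>v b) = Y ^\<^sub>m Suc k *\<^sub>v b" using Y Suc
    by (simp add: assoc_mult_mat_vec[of _ r r _ r])
  finally show ?case .
qed

lemma jordan_block_shift: "jordan_block m (a :: complex) - a \<cdot>\<^sub>m 1\<^sub>m m = jordan_block m 0"
  by (intro eq_matI, auto simp: jordan_block_index)

lemma jordan_block_zero_pow_self: "(jordan_block m (0 :: complex)) ^\<^sub>m m = 0\<^sub>m m m"
  unfolding jordan_block_zero_pow by (intro eq_matI, auto)

lemma unit_vec_append_left: "i < m \<Longrightarrow> unit_vec (m + r) i = (unit_vec m i @\<^sub>v 0\<^sub>v r :: complex vec)"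
  by (intro eq_vecI, auto)

lemma unit_vec_append_right:
  "m \<le> i \<Longrightarrow> i < m + r \<Longrightarrow> unit_vec (m + r) i = (0\<^sub>v m @\<^sub>v unit_vec r (i - m) :: complex vec)"
  by (intro eq_vecI, auto)

lemma jordan_matrix_shift_pow_kills_unit_vec: "i < sum_list (map fst n_as) \<Longrightarrow> \<exists>z k.
  ((jordan_matrix n_as - z \<cdot>\<^sub>m 1\<^sub>m (sum_list (map fst n_as))) ^\<^sub>m k) *\<^sub>v unit_vec (sum_list (map fst n_as)) i
    = (0\<^sub>v (sum_list (map fst n_as)) :: complex vec)"
proof (induct n_as arbitrary: i)
  case Nil
  then show ?case by simp
next
  case (Cons ma n_as)
  obtain m a where ma: "ma = (m, a)" by force
  let ?r = "sum_list (map fst n_as)"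
  let ?J = "jordan_matrix n_as"
  have J: "?J \<in> carrier_mat ?r ?r" by auto
  have JB: "jordan_block m a \<in> carrier_mat m m" by auto
  have s: "sum_list (map fst (ma # n_as)) = m + ?r" unfolding ma by simp
  have jm: "jordan_matrix (ma # n_as) = four_block_mat (jordan_block m a) (0\<^sub>m m ?r) (0\<^sub>m ?r m) ?J"
    unfolding ma jordan_matrix_Cons by simp
  have key: "\<And>z k x y. x \<in> carrier_vec m \<Longrightarrow> y \<in> carrier_vec ?r \<Longrightarrow>
    ((jordan_matrix (ma # n_as) - z \<cdot>\<^sub>m 1\<^sub>m (m + ?r)) ^\<^sub>m k) *\<^sub>v (x @\<^sub>v y) =
    ((jordan_block m a - z \<cdot>\<^sub>m 1\<^sub>m m) ^\<^sub>m k *\<^sub>v x) @\<^sub>v ((?J - z \<cdot>\<^sub>m 1\<^sub>m ?r) ^\<^sub>m k *\<^sub>v y)"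
    unfolding jm four_block_diag_shift[OF JB J]
    by (rule four_block_diag_pow_mult_vec) (use JB J in auto)
  show ?case
  proof (cases "i < m")
    case True
    have "((jordan_matrix (ma # n_as) - a \<cdot>\<^sub>m 1\<^sub>m (m + ?r)) ^\<^sub>m m) *\<^sub>v unit_vec (m + ?r) i = 0\<^sub>v (m + ?r)"
      unfolding unit_vec_append_left[OF True] key[OF unit_vec_carrier zero_carrier_vec]
        jordan_block_shift jordan_block_zero_pow_self
        mult_mat_zero_vec[OF pow_carrier_mat[OF shift_carrier[OF J]]]
      by (intro eq_vecI, auto)
    thus ?thesis unfolding s by blast
  next
    case False
    with Cons(2) s have i: "i - m < ?r" by auto
    from Cons(1)[OF i] obtain z k
      where zk: "((?J - z \<cdot>\<^sub>m 1\<^sub>m ?r) ^\<^sub>m k) *\<^sub>v unit_vec ?r (i - m) = 0\<^sub>v ?r" by auto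
    have eq: "unit_vec (m + ?r) i = (0\<^sub>v m @\<^sub>v unit_vec ?r (i - m) :: complex vec)"
      by (rule unit_vec_append_right, use False Cons(2) s in auto)
    have "((jordan_matrix (ma # n_as) - z \<cdot>\<^sub>m 1\<^sub>m (m + ?r)) ^\<^sub>m k) *\<^sub>v unit_vec (m + ?r) i = 0\<^sub>v (m + ?r)"
      unfolding eq key[OF zero_carrier_vec unit_vec_carrier] zk
        mult_mat_zero_vec[OF pow_carrier_mat[OF shift_carrier[OF JB]]]
      by (intro eq_vecI, auto)
    thus ?thesis unfolding s by blast
  qed
qed

lemma col_eq_mult_unit_vec:
  "(P :: complex mat) \<in> carrier_mat N N \<Longrightarrow> i < N \<Longrightarrow> col P i = P *\<^sub>v unit_vec N i"
  by (intro eq_vecI, auto simp: scalar_prod_right_unit)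

lemma gen_eigvec_basis_exists: assumes M: "M \<in> carrier_mat N N"
  shows "\<exists>P Q lam. P \<in> carrier_mat N N \<and> Q \<in> carrier_mat N N \<and> P * Q = 1\<^sub>m N \<and> Q * P = 1\<^sub>m N
     \<and> (\<forall>i<N. gen_eigvec N M (lam i) (col P i))"
proof -
  from char_poly_factorized[OF M] obtain as where "char_poly M = (\<Prod>a\<leftarrow>as. [:- a, 1:])" by auto
  from jordan_nf_exists[OF M this] obtain n_as where "jordan_nf M n_as" by auto
  hence "similar_mat M (jordan_matrix n_as)" unfolding jordan_nf_def by auto
  then obtain P Q where wit: "similar_mat_wit M (jordan_matrix n_as) P Q"
    unfolding similar_mat_def by auto
  note w = similar_mat_witD2[OF M wit]
  let ?J = "jordan_matrix n_as"
  have sN: "sum_list (map fst n_as) = N" using w(5) by auto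
  have "\<forall>i<N. \<exists>z. gen_eigvec N M z (col P i)"
  proof (intro allI impI)
    fix i assume i: "i < N"
    from jordan_matrix_shift_pow_kills_unit_vec[of i n_as, unfolded sN, OF i] obtain z k where
      zk: "((?J - z \<cdot>\<^sub>m 1\<^sub>m N) ^\<^sub>m k) *\<^sub>v unit_vec N i = 0\<^sub>v N" by auto
    have cm: "\<And>A. A \<in> carrier_mat N N \<Longrightarrow> char_matrix A z = A - z \<cdot>\<^sub>m 1\<^sub>m N"
      unfolding char_matrix_def by (intro eq_matI, auto)
    have wit2: "similar_mat_wit ((M - z \<cdot>\<^sub>m 1\<^sub>m N) ^\<^sub>m k) ((?J - z \<cdot>\<^sub>m 1\<^sub>m N) ^\<^sub>m k) P Q"
      using similar_mat_wit_pow[OF similar_mat_wit_char_matrix[OF wit, of z]]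
      unfolding cm[OF M] cm[OF w(5)] .
    note w2 = similar_mat_witD2[OF _ wit2, of N]
    let ?A = "(M - z \<cdot>\<^sub>m 1\<^sub>m N) ^\<^sub>m k" let ?B = "(?J - z \<cdot>\<^sub>m 1\<^sub>m N) ^\<^sub>m k"
    have A: "?A \<in> carrier_mat N N" using M by auto
    have B: "?B \<in> carrier_mat N N" using w(5) by auto
    have "?A *\<^sub>v col P i = P * ?B * Q *\<^sub>v (P *\<^sub>v unit_vec N i)"
      unfolding col_eq_mult_unit_vec[OF w(6) i] using w2(3)[OF A] by simp
    also have "\<dots> = P *\<^sub>v (?B *\<^sub>v ((Q * P) *\<^sub>v unit_vec N i))"
      using w(6) w(7) B by (simp add: assoc_mult_mat_vec[of _ N N _ N] assoc_mult_mat[of _ N N _ N _ N])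
    also have "\<dots> = 0\<^sub>v N" unfolding w(2) using zk w(6) by simp
    finally have "?A *\<^sub>v col P i = 0\<^sub>v N" .
    thus "\<exists>z. gen_eigvec N M z (col P i)" unfolding gen_eigvec_def using w(6) i
      by (intro exI[of _ z] conjI exI[of _ k], auto)
  qed
  then obtain lam where "\<forall>i<N. gen_eigvec N M (lam i) (col P i)" by metis
  thus ?thesis using w by blast
qed

section \<open>Orthogonal projectors\<close>

fun lin_span :: "nat \<Rightarrow> complex vec list \<Rightarrow> complex vec set" where
  "lin_span N [] = {0\<^sub>v N}"
| "lin_span N (v # vs) = {c \<cdot>\<^sub>v v + y | c y. y \<in> lin_span N vs}"

lemma lin_span_carrier: "set vs \<subseteq> carrier_vec N \<Longrightarrow> y \<in> lin_span N vs \<Longrightarrow> y \<in> carrier_vec N"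
  by (induct vs arbitrary: y, auto)

lemma lin_span_subset:
  assumes "set vs \<subseteq> carrier_vec N" and "0\<^sub>v N \<in> S"
    and "\<And>x y. x \<in> S \<Longrightarrow> y \<in> S \<Longrightarrow> x + y \<in> S" and "\<And>c x. x \<in> S \<Longrightarrow> c \<cdot>\<^sub>v x \<in> S"
    and "set vs \<subseteq> S"
  shows "lin_span N vs \<subseteq> S"
  using assms by (induct vs, auto)

lemma smult_mat_mult_vec:
  "A \<in> carrier_mat nr nc \<Longrightarrow> v \<in> carrier_vec nc \<Longrightarrow> (c \<cdot>\<^sub>m A) *\<^sub>v v = c \<cdot>\<^sub>v (A *\<^sub>v (v :: complex vec))"
  by (intro eq_vecI, auto simp: scalar_prod_def sum_distrib_left mult.assoc)

lemma mat_eq_by_mult_vec: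
  assumes A: "(A :: complex mat) \<in> carrier_mat N N" and B: "B \<in> carrier_mat N N"
    and e: "\<And>v. v \<in> carrier_vec N \<Longrightarrow> A *\<^sub>v v = B *\<^sub>v v"
  shows "A = B"
proof (rule mat_col_eqI)
  fix i assume i: "i < dim_col B"
  have "col A i = A *\<^sub>v unit_vec N i" using A i B by (intro eq_vecI, auto simp: scalar_prod_right_unit)
  also have "\<dots> = B *\<^sub>v unit_vec N i" by (rule e, auto)
  also have "\<dots> = col B i" using A i B by (intro eq_vecI, auto simp: scalar_prod_right_unit)
  finally show "col A i = col B i" .
qed (use A B in auto)

lemma mat_range_memI: "P \<in> carrier_mat N N \<Longrightarrow> x \<in> carrier_vec N \<Longrightarrow> P *\<^sub>v x \<in> mat_range P"
  unfolding mat_range_def by auto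

lemma orth_proj_carrier: "is_orth_proj N S P \<Longrightarrow> P \<in> carrier_mat N N"
  unfolding is_orth_proj_def by auto

lemma orth_proj_range: "is_orth_proj N S P \<Longrightarrow> v \<in> carrier_vec N \<Longrightarrow> P *\<^sub>v v \<in> S"
  unfolding is_orth_proj_def mat_range_def by auto

lemma orth_proj_fixes:
  assumes P: "is_orth_proj N S P" and x: "x \<in> S"
  shows "P *\<^sub>v x = x"
proof -
  have Pc: "P \<in> carrier_mat N N" and PP: "P * P = P" and r: "mat_range P = S"
    using P unfolding is_orth_proj_def by auto
  from x r obtain u where u: "u \<in> carrier_vec N" and xu: "x = P *\<^sub>v u"
    unfolding mat_range_def using Pc by auto
  show ?thesis unfolding xu using Pc u PP by (metis assoc_mult_mat_vec)
qed

lemma orth_proj_subset_carrier: "is_orth_proj N S P \<Longrightarrow> S \<subseteq> carrier_vec N"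
  unfolding is_orth_proj_def mat_range_def by auto

lemma orth_proj_cinner:
  "is_orth_proj N S P \<Longrightarrow> u \<in> carrier_vec N \<Longrightarrow> v \<in> carrier_vec N \<Longrightarrow>
    cinner u (P *\<^sub>v v) = cinner (P *\<^sub>v u) v"
  using cinner_adjoint[of P N N u v] unfolding is_orth_proj_def by auto

lemma orth_proj_kernel_orthogonal:
  assumes P: "is_orth_proj N S P" and d: "d \<in> S" and y: "y \<in> carrier_vec N" and Py: "P *\<^sub>v y = 0\<^sub>v N"
  shows "cinner d y = 0"
proof -
  have "cinner d y = cinner (P *\<^sub>v d) y" by (simp add: orth_proj_fixes[OF P d])
  also have "\<dots> = cinner d (P *\<^sub>v y)"
    using orth_proj_cinner[OF P _ y] orth_proj_subset_carrier[OF P] d by auto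
  finally show ?thesis unfolding Py using cinner_zero_right orth_proj_subset_carrier[OF P] d by auto
qed

lemma orth_proj_lincomb_mem:
  assumes P: "is_orth_proj N S P" and x: "x \<in> S" and y: "y \<in> S"
  shows "a \<cdot>\<^sub>v x + y \<in> S"
proof -
  have Pc: "P \<in> carrier_mat N N" by (rule orth_proj_carrier[OF P])
  have xc: "x \<in> carrier_vec N" and yc: "y \<in> carrier_vec N"
    using orth_proj_subset_carrier[OF P] x y by auto
  have "P *\<^sub>v (a \<cdot>\<^sub>v x + y) = a \<cdot>\<^sub>v x + y"
    using Pc xc yc orth_proj_fixes[OF P x] orth_proj_fixes[OF P y]
    by (simp add: mult_add_distrib_mat_vec[of _ N N] mult_mat_vec[of _ N N])
  moreover have "P *\<^sub>v (a \<cdot>\<^sub>v x + y) \<in> S" using orth_proj_range[OF P] xc yc by auto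
  ultimately show ?thesis by simp
qed

lemma orth_proj_unique:
  assumes P: "is_orth_proj N S P" and Q: "is_orth_proj N S Q"
  shows "P = Q"
proof -
  have Pc: "P \<in> carrier_mat N N" and Pa: "mat_adjoint P = P" using P unfolding is_orth_proj_def by auto
  have Qc: "Q \<in> carrier_mat N N" and Qa: "mat_adjoint Q = Q" using Q unfolding is_orth_proj_def by auto
  have PQ: "P * Q = Q"
    by (rule mat_eq_by_mult_vec[of _ N], use Pc Qc in \<open>auto simp: assoc_mult_mat_vec[of _ N N _ N]
       orth_proj_fixes[OF P orth_proj_range[OF Q]]\<close>)
  have QP: "Q * P = P"
    by (rule mat_eq_by_mult_vec[of _ N], use Pc Qc in \<open>auto simp: assoc_mult_mat_vec[of _ N N _ N]
       orth_proj_fixes[OF Q orth_proj_range[OF P]]\<close>)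
  have "Q = mat_adjoint (P * Q)" unfolding PQ Qa ..
  also have "\<dots> = Q * P" using adjoint_mult[OF Pc Qc] Pa Qa by simp
  finally show ?thesis unfolding QP by simp
qed

lemma orth_proj_eqI: "is_orth_proj N S P \<Longrightarrow> orth_proj N S = P"
  unfolding orth_proj_def using orth_proj_unique by blast

definition outer_mat :: "complex vec \<Rightarrow> complex mat" where
  "outer_mat r = mat (dim_vec r) (dim_vec r) (\<lambda>(i,j). r $ i * cnj (r $ j))"

lemma outer_mat_carrier: "r \<in> carrier_vec N \<Longrightarrow> outer_mat r \<in> carrier_mat N N"
  unfolding outer_mat_def by auto

lemma outer_mat_mult_vec:
  "r \<in> carrier_vec N \<Longrightarrow> v \<in> carrier_vec N \<Longrightarrow> outer_mat r *\<^sub>v v = cinner r v \<cdot>\<^sub>v r"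
  unfolding outer_mat_def cinner_def
  by (intro eq_vecI, auto simp: scalar_prod_def sum_distrib_left algebra_simps)

lemma adjoint_outer_mat: "r \<in> carrier_vec N \<Longrightarrow> mat_adjoint (outer_mat r) = outer_mat r"
  unfolding outer_mat_def by (intro eq_matI, auto)

text \<open>One Gram--Schmidt step: \<open>P r = 0\<close> says that \<open>r \<perp> S\<close>, so adding the projector onto
  \<open>span {r}\<close> gives the projector onto \<open>S + span {r}\<close>.\<close>

definition rank_one_update :: "complex mat \<Rightarrow> complex vec \<Rightarrow> complex mat" where
  "rank_one_update P r = P + (1 / cinner r r) \<cdot>\<^sub>m outer_mat r"

context
  fixes N :: nat and S :: "complex vec set" and P :: "complex mat" and r :: "complex vec"
  assumes P: "is_orth_proj N S P" and r: "r \<in> carrier_vec N"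
    and Pr: "P *\<^sub>v r = 0\<^sub>v N" and r0: "r \<noteq> 0\<^sub>v N"
begin

lemma rank_one_update_carrier: "rank_one_update P r \<in> carrier_mat N N"
  unfolding rank_one_update_def using orth_proj_carrier[OF P] outer_mat_carrier[OF r] by auto

lemma rank_one_update_mult_vec:
  "v \<in> carrier_vec N \<Longrightarrow> rank_one_update P r *\<^sub>v v = P *\<^sub>v v + (cinner r v / cinner r r) \<cdot>\<^sub>v r"
  unfolding rank_one_update_def using orth_proj_carrier[OF P] outer_mat_carrier[OF r] r
  by (simp add: add_mult_distrib_mat_vec[of _ N N] smult_mat_mult_vec[of _ N N] outer_mat_mult_vec
      smult_smult_assoc)

lemma rank_one_update_fixes:
  shows "y \<in> S \<Longrightarrow> rank_one_update P r *\<^sub>v y = y" and "rank_one_update P r *\<^sub>v r = r"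
proof -
  show "rank_one_update P r *\<^sub>v y = y" if y: "y \<in> S" for y
  proof -
    have yc: "y \<in> carrier_vec N" and Py: "P *\<^sub>v y = y"
      using orth_proj_subset_carrier[OF P] y orth_proj_fixes[OF P y] by auto
    have "cinner r y = 0" using orth_proj_cinner[OF P r yc] Pr Py by simp
    thus ?thesis unfolding rank_one_update_mult_vec[OF yc] Py using yc r by (intro eq_vecI, auto)
  qed
  have "cinner r r \<noteq> 0" using cinner_self_eq_0[OF r] r0 by auto
  thus "rank_one_update P r *\<^sub>v r = r"
    unfolding rank_one_update_mult_vec[OF r] Pr using r by (intro eq_vecI, auto)
qed

lemma orth_proj_add_orthogonal: "is_orth_proj N {c \<cdot>\<^sub>v r + y | c y. y \<in> S} (rank_one_update P r)"
proof -
  let ?Q = "rank_one_update P r"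
  have Pc: "P \<in> carrier_mat N N" and Pa: "mat_adjoint P = P" using P unfolding is_orth_proj_def by auto
  note Qc = rank_one_update_carrier and Qv = rank_one_update_mult_vec
  have "?Q * ?Q = ?Q"
  proof (rule mat_eq_by_mult_vec[OF _ Qc])
    fix v :: "complex vec" assume v: "v \<in> carrier_vec N"
    have "(?Q * ?Q) *\<^sub>v v = ?Q *\<^sub>v (?Q *\<^sub>v v)" using Qc v by (simp add: assoc_mult_mat_vec[of _ N N _ N])
    also have "\<dots> = ?Q *\<^sub>v (P *\<^sub>v v) + (cinner r v / cinner r r) \<cdot>\<^sub>v (?Q *\<^sub>v r)"
      unfolding Qv[OF v] using Qc Pc v r
      by (simp add: mult_add_distrib_mat_vec[of _ N N] mult_mat_vec[of _ N N])
    also have "\<dots> = ?Q *\<^sub>v v"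
      unfolding rank_one_update_fixes(1)[OF orth_proj_range[OF P v]] rank_one_update_fixes(2) Qv[OF v]
      ..
    finally show "(?Q * ?Q) *\<^sub>v v = ?Q *\<^sub>v v" .
  qed (use Qc in auto)
  moreover have "mat_adjoint ?Q = ?Q"
  proof -
    have "cnj (cinner r r) = cinner r r" unfolding cinner_self by (simp add: complex_eq_iff)
    thus ?thesis unfolding rank_one_update_def using Pc outer_mat_carrier[OF r]
      by (simp add: adjoint_add[of _ N N] adjoint_smult Pa adjoint_outer_mat[OF r])
  qed
  moreover have "mat_range ?Q = {c \<cdot>\<^sub>v r + y | c y. y \<in> S}"
  proof (intro equalityI subsetI)
    fix w assume "w \<in> mat_range ?Q"
    then obtain v where v: "v \<in> carrier_vec N" and w: "w = ?Q *\<^sub>v v"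
      unfolding mat_range_def using Qc by auto
    have "w = (cinner r v / cinner r r) \<cdot>\<^sub>v r + P *\<^sub>v v"
      unfolding w Qv[OF v] using Pc v r by (intro eq_vecI, auto)
    thus "w \<in> {c \<cdot>\<^sub>v r + y | c y. y \<in> S}" using orth_proj_range[OF P v] by blast
  next
    fix w assume "w \<in> {c \<cdot>\<^sub>v r + y | c y. y \<in> S}"
    then obtain c y where w: "w = c \<cdot>\<^sub>v r + y" and y: "y \<in> S" by auto
    have yc: "y \<in> carrier_vec N" using orth_proj_subset_carrier[OF P] y by auto
    have "?Q *\<^sub>v w = w" unfolding w using Qc r yc rank_one_update_fixes(2) rank_one_update_fixes(1)[OF y]
      by (simp add: mult_add_distrib_mat_vec[of _ N N] mult_mat_vec[of _ N N])
    thus "w \<in> mat_range ?Q" using mat_range_memI[OF Qc, of w] r yc unfolding w by auto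
  qed
  ultimately show ?thesis unfolding is_orth_proj_def using Qc by auto
qed

end

lemma orth_proj_insert:
  assumes P: "is_orth_proj N S P" and x: "x \<in> carrier_vec N"
  shows "\<exists>P'. is_orth_proj N {c \<cdot>\<^sub>v x + y | c y. y \<in> S} P'"
proof -
  have Pc: "P \<in> carrier_mat N N" by (rule orth_proj_carrier[OF P])
  have Sc: "S \<subseteq> carrier_vec N" by (rule orth_proj_subset_carrier[OF P])
  have PxS: "P *\<^sub>v x \<in> S" by (rule orth_proj_range[OF P x])
  define r where "r = x - P *\<^sub>v x"
  have rc: "r \<in> carrier_vec N" unfolding r_def using x Pc by auto
  have Pr: "P *\<^sub>v r = 0\<^sub>v N"
    unfolding r_def using Pc x orth_proj_fixes[OF P PxS]
    by (simp add: mult_minus_distrib_mat_vec[of _ N N])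
  have span_eq: "{c \<cdot>\<^sub>v x + y | c y. y \<in> S} = {c \<cdot>\<^sub>v r + y | c y. y \<in> S}"
  proof (intro equalityI subsetI)
    fix w assume "w \<in> {c \<cdot>\<^sub>v x + y | c y. y \<in> S}"
    then obtain c y where w: "w = c \<cdot>\<^sub>v x + y" and y: "y \<in> S" by auto
    have "w = c \<cdot>\<^sub>v r + (c \<cdot>\<^sub>v (P *\<^sub>v x) + y)"
      unfolding w r_def using x Pc Sc y by (intro eq_vecI, auto simp: algebra_simps)
    thus "w \<in> {c \<cdot>\<^sub>v r + y | c y. y \<in> S}" using orth_proj_lincomb_mem[OF P PxS y] by blast
  next
    fix w assume "w \<in> {c \<cdot>\<^sub>v r + y | c y. y \<in> S}"
    then obtain c y where w: "w = c \<cdot>\<^sub>v r + y" and y: "y \<in> S" by auto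
    have "w = c \<cdot>\<^sub>v x + ((- c) \<cdot>\<^sub>v (P *\<^sub>v x) + y)"
      unfolding w r_def using x Pc Sc y by (intro eq_vecI, auto simp: algebra_simps)
    thus "w \<in> {c \<cdot>\<^sub>v x + y | c y. y \<in> S}" using orth_proj_lincomb_mem[OF P PxS y] by blast
  qed
  show ?thesis
  proof (cases "r = 0\<^sub>v N")
    case True
    have "{c \<cdot>\<^sub>v r + y | c y. y \<in> S} = S"
    proof (intro equalityI subsetI)
      fix w assume "w \<in> {c \<cdot>\<^sub>v r + y | c y. y \<in> S}"
      thus "w \<in> S" using True Sc by auto
    next
      fix w assume w: "w \<in> S"
      hence "w = 0 \<cdot>\<^sub>v r + w" using True Sc by auto
      thus "w \<in> {c \<cdot>\<^sub>v r + y | c y. y \<in> S}" using w by blast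
    qed
    thus ?thesis using P span_eq by auto
  next
    case False
    show ?thesis unfolding span_eq using orth_proj_add_orthogonal[OF P rc Pr False] by blast
  qed
qed

lemma orth_proj_lin_span_exists: "set vs \<subseteq> carrier_vec N \<Longrightarrow> \<exists>P. is_orth_proj N (lin_span N vs) P"
proof (induct vs)
  case Nil
  have "is_orth_proj N (lin_span N []) (0\<^sub>m N N)"
    unfolding is_orth_proj_def mat_range_def by (auto intro!: eq_vecI exI[of _ "0\<^sub>v N"])
  thus ?case by blast
next
  case (Cons x vs)
  then obtain P where "is_orth_proj N (lin_span N vs) P" by auto
  thus ?case using orth_proj_insert Cons(2) by simp
qed

section \<open>Distance of two projectors\<close>

lemma vec_norm2_cinner: "vec_norm2 v = sqrt (Re (cinner v v))"
  unfolding vec_norm2_def Re_cinner_self by (simp add: atLeast0LessThan)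

lemma cinner_mult_vec_bound:
  assumes B: "(B :: complex mat) \<in> carrier_mat N N"
  shows "\<exists>K \<ge> 1. \<forall>w \<in> carrier_vec N. Re (cinner (B *\<^sub>v w) (B *\<^sub>v w)) \<le> K * Re (cinner w w)"
proof -
  define r where "r i = (\<Sum>j = 0..<N. cmod (B $$ (i,j)))" for i
  define K where "K = 1 + (\<Sum>i = 0..<N. (r i)^2)"
  have K1: "K \<ge> 1" unfolding K_def by (auto intro: sum_nonneg)
  show ?thesis
  proof (intro exI[of _ K] conjI K1 ballI)
    fix w :: "complex vec" assume w: "w \<in> carrier_vec N"
    define S where "S = (\<Sum>k = 0..<N. (cmod (w $ k))^2)"
    have S0: "0 \<le> S" unfolding S_def by (auto intro: sum_nonneg)
    have wS: "Re (cinner w w) = S" unfolding Re_cinner_self S_def using w by simp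
    have wj: "cmod (w $ j) \<le> sqrt S" if j: "j < N" for j
    proof -
      have "(cmod (w $ j))^2 \<le> S" unfolding S_def
        by (rule member_le_sum[of j "{0..<N}" "\<lambda>k. (cmod (w $ k))^2"], use j in auto)
      thus ?thesis by (simp add: real_le_rsqrt)
    qed
    have comp: "(cmod ((B *\<^sub>v w) $ i))^2 \<le> (r i)^2 * S" if i: "i < N" for i
    proof -
      have "(B *\<^sub>v w) $ i = (\<Sum>j = 0..<N. B $$ (i,j) * w $ j)" using B w i by (simp add: scalar_prod_def)
      hence "cmod ((B *\<^sub>v w) $ i) \<le> (\<Sum>j = 0..<N. cmod (B $$ (i,j)) * cmod (w $ j))"
        by (metis (no_types, lifting) norm_mult norm_sum sum.cong)
      also have "\<dots> \<le> (\<Sum>j = 0..<N. cmod (B $$ (i,j)) * sqrt S)"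
        by (rule sum_mono, rule mult_left_mono, use wj in auto)
      also have "\<dots> = r i * sqrt S" unfolding r_def by (simp add: sum_distrib_right)
      finally have "(cmod ((B *\<^sub>v w) $ i))^2 \<le> (r i * sqrt S)^2" by (rule power_mono, auto)
      also have "\<dots> = (r i)^2 * S" using S0 by (simp add: power_mult_distrib)
      finally show ?thesis .
    qed
    have "Re (cinner (B *\<^sub>v w) (B *\<^sub>v w)) = (\<Sum>i = 0..<N. (cmod ((B *\<^sub>v w) $ i))^2)"
      unfolding Re_cinner_self using B by simp
    also have "\<dots> \<le> (\<Sum>i = 0..<N. (r i)^2 * S)" by (rule sum_mono, rule comp, auto)
    also have "\<dots> = (\<Sum>i = 0..<N. (r i)^2) * S" by (simp add: sum_distrib_right)
    also have "\<dots> \<le> K * S" unfolding K_def using S0 by (simp add: mult_right_mono)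
    finally show "Re (cinner (B *\<^sub>v w) (B *\<^sub>v w)) \<le> K * Re (cinner w w)" unfolding wS .
  qed
qed

lemma spec_norm_le:
  assumes B: "B \<in> carrier_mat N N"
    and bound: "\<And>v. v \<in> carrier_vec N \<Longrightarrow> vec_norm2 v \<le> 1 \<Longrightarrow> vec_norm2 (B *\<^sub>v v) \<le> c"
  shows "spec_norm B \<le> c"
  unfolding spec_norm_def
proof (rule cSup_least)
  show "{vec_norm2 (B *\<^sub>v v) |v. v \<in> carrier_vec (dim_col B) \<and> vec_norm2 v \<le> 1} \<noteq> {}"
    using B by (auto intro!: exI[of _ "0\<^sub>v N"] simp: vec_norm2_def)
qed (use B bound in auto)

lemma one_minus_minus_mult_vec:
  assumes "P1 \<in> carrier_mat N N" "P2 \<in> carrier_mat N N" "(v :: complex vec) \<in> carrier_vec N"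
  shows "(1\<^sub>m N - P1 - P2) *\<^sub>v v = v - P1 *\<^sub>v v - P2 *\<^sub>v v"
proof -
  have "(1\<^sub>m N - P1 - P2) *\<^sub>v v = (1\<^sub>m N - P1) *\<^sub>v v - P2 *\<^sub>v v"
    by (rule minus_mult_distrib_mat_vec, use assms in auto)
  also have "(1\<^sub>m N - P1) *\<^sub>v v = v - P1 *\<^sub>v v"
    using minus_mult_distrib_mat_vec[of "1\<^sub>m N" N N P1 v] assms by simp
  finally show ?thesis .
qed

text \<open>The operator identity \<open>(P - Q)\<^sup>2 + (I - P - Q)\<^sup>2 = I\<close> for orthogonal projectors.\<close>

lemma orth_proj_diff_pythagoras:
  assumes P1: "is_orth_proj N S1 P1" and P2: "is_orth_proj N S2 P2" and v: "v \<in> carrier_vec N"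
  shows "cinner ((P1 - P2) *\<^sub>v v) ((P1 - P2) *\<^sub>v v)
      + cinner ((1\<^sub>m N - P1 - P2) *\<^sub>v v) ((1\<^sub>m N - P1 - P2) *\<^sub>v v) = cinner v v"
proof -
  have P1c: "P1 \<in> carrier_mat N N" and P2c: "P2 \<in> carrier_mat N N"
    using P1 P2 by (auto intro: orth_proj_carrier)
  define p where "p = P1 *\<^sub>v v"
  define q where "q = P2 *\<^sub>v v"
  have pc: "p \<in> carrier_vec N" and qc: "q \<in> carrier_vec N" unfolding p_def q_def using P1c P2c v by auto
  have X: "(P1 - P2) *\<^sub>v v = p - q"
    unfolding p_def q_def using P1c P2c v by (simp add: minus_mult_distrib_mat_vec)
  have Q: "(1\<^sub>m N - P1 - P2) *\<^sub>v v = v - p - q"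
    unfolding p_def q_def by (rule one_minus_minus_mult_vec[OF P1c P2c v])
  have vp: "cinner v p = cinner p p" and pv: "cinner p v = cinner p p"
    using orth_proj_cinner[OF P1 v pc] orth_proj_cinner[OF P1 v v]
      orth_proj_fixes[OF P1 orth_proj_range[OF P1 v]] unfolding p_def by simp_all
  have vq: "cinner v q = cinner q q" and qv: "cinner q v = cinner q q"
    using orth_proj_cinner[OF P2 v qc] orth_proj_cinner[OF P2 v v]
      orth_proj_fixes[OF P2 orth_proj_range[OF P2 v]] unfolding q_def by simp_all
  have e1: "cinner (p - q) (p - q) = cinner p p - cinner p q - cinner q p + cinner q q"
    using pc qc by (simp add: cinner_diff_left[of _ N] cinner_diff_right[of _ N])
  have e2: "cinner (v - p - q) (v - p - q) = cinner v v - cinner v p - cinner v q - cinner p v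
      + cinner p p + cinner p q - cinner q v + cinner q p + cinner q q"
    using pc qc v by (simp add: cinner_diff_left[of _ N] cinner_diff_right[of _ N] algebra_simps)
  show ?thesis unfolding X Q e1 e2 vp pv vq qv by (simp add: algebra_simps)
qed

lemma spec_norm_orth_proj_diff_lt_1_if_invertible:
  assumes P1: "is_orth_proj N S1 P1" and P2: "is_orth_proj N S2 P2"
    and inj: "\<And>v. v \<in> carrier_vec N \<Longrightarrow> (1\<^sub>m N - P1 - P2) *\<^sub>v v = 0\<^sub>v N \<Longrightarrow> v = 0\<^sub>v N"
  shows "spec_norm (P1 - P2) < 1"
proof -
  have P1c: "P1 \<in> carrier_mat N N" and P2c: "P2 \<in> carrier_mat N N"
    using P1 P2 by (auto intro: orth_proj_carrier)
  let ?Q = "1\<^sub>m N - P1 - P2"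
  have Qc: "?Q \<in> carrier_mat N N" using P1c P2c by auto
  have "det ?Q \<noteq> 0" unfolding det_0_iff_vec_prod_zero[OF Qc] using inj by auto
  then obtain B where Bc: "B \<in> carrier_mat N N" and BQ: "B * ?Q = 1\<^sub>m N"
    using det_non_zero_imp_unit[OF Qc] unfolding Units_def ring_mat_def by auto
  from cinner_mult_vec_bound[OF Bc] obtain K where K1: "K \<ge> 1"
    and Kb: "\<forall>w \<in> carrier_vec N. Re (cinner (B *\<^sub>v w) (B *\<^sub>v w)) \<le> K * Re (cinner w w)" by auto
  define c where "c = sqrt (1 - 1 / K)"
  have "vec_norm2 ((P1 - P2) *\<^sub>v v) \<le> c" if v: "v \<in> carrier_vec N" and vn: "vec_norm2 v \<le> 1" for v
  proof -
    have Qv: "?Q *\<^sub>v v \<in> carrier_vec N" using Qc v by auto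
    have "B *\<^sub>v (?Q *\<^sub>v v) = v"
      using BQ Bc Qc v by (simp add: assoc_mult_mat_vec[symmetric, of _ N N _ N])
    hence vQ: "Re (cinner v v) \<le> K * Re (cinner (?Q *\<^sub>v v) (?Q *\<^sub>v v))" using Kb Qv by metis
    have "Re (cinner ((P1 - P2) *\<^sub>v v) ((P1 - P2) *\<^sub>v v))
        = Re (cinner v v) - Re (cinner (?Q *\<^sub>v v) (?Q *\<^sub>v v))"
      using arg_cong[OF orth_proj_diff_pythagoras[OF P1 P2 v], of Re] by simp
    also have "\<dots> \<le> (1 - 1 / K) * Re (cinner v v)" using vQ K1 by (simp add: field_simps)
    also have "\<dots> \<le> 1 - 1 / K"
      using vn Re_cinner_self_nonneg[of v] K1 unfolding vec_norm2_cinner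
      by (simp add: real_sqrt_le_1_iff mult_left_le)
    finally show ?thesis unfolding vec_norm2_cinner c_def by simp
  qed
  hence "spec_norm (P1 - P2) \<le> c" using P1c P2c by (intro spec_norm_le[of _ N]) auto
  moreover have "c < 1" unfolding c_def using K1 by (simp add: real_sqrt_lt_1_iff)
  ultimately show ?thesis by simp
qed

lemma spec_norm_orth_proj_diff_lt_1:
  assumes P1: "is_orth_proj N S1 P1" and P2: "is_orth_proj N S2 P2"
    and S1: "\<And>x. x \<in> S1 \<Longrightarrow> P2 *\<^sub>v x = 0\<^sub>v N \<Longrightarrow> x = 0\<^sub>v N"
    and S2: "\<And>y. y \<in> S2 \<Longrightarrow> P1 *\<^sub>v y = 0\<^sub>v N \<Longrightarrow> y = 0\<^sub>v N"
  shows "spec_norm (P1 - P2) < 1"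
proof (rule spec_norm_orth_proj_diff_lt_1_if_invertible[OF P1 P2])
  fix v :: "complex vec" assume v: "v \<in> carrier_vec N" and Qv: "(1\<^sub>m N - P1 - P2) *\<^sub>v v = 0\<^sub>v N"
  have P1c: "P1 \<in> carrier_mat N N" and P2c: "P2 \<in> carrier_mat N N"
    using P1 P2 by (auto intro: orth_proj_carrier)
  define p where "p = P1 *\<^sub>v v"
  define q where "q = P2 *\<^sub>v v"
  have pS: "p \<in> S1" and qS: "q \<in> S2"
    unfolding p_def q_def using v P1 P2 by (auto intro: orth_proj_range)
  have pc: "p \<in> carrier_vec N" and qc: "q \<in> carrier_vec N" unfolding p_def q_def using P1c P2c v by auto
  have "v - p - q = 0\<^sub>v N"
    using Qv unfolding p_def q_def one_minus_minus_mult_vec[OF P1c P2c v] .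
  hence vpq: "v = p + q" using v pc qc by (rule diff_diff_vec_eq_zero_imp_eq)
  have "P2 *\<^sub>v p + q = q"
    using arg_cong[OF vpq, of "(*\<^sub>v) P2"] orth_proj_fixes[OF P2 qS] pc qc P2c
    unfolding q_def[symmetric] by (simp add: mult_add_distrib_mat_vec[of _ N N])
  hence "P2 *\<^sub>v p = 0\<^sub>v N" using P2c pc qc by (intro add_vec_eq_right_imp_zero) auto
  hence p0: "p = 0\<^sub>v N" using S1[OF pS] by simp
  have "P1 *\<^sub>v q + p = p"
    using arg_cong[OF vpq, of "(*\<^sub>v) P1"] orth_proj_fixes[OF P1 pS] pc qc P1c
    unfolding p_def[symmetric] by (simp add: mult_add_distrib_mat_vec[of _ N N] comm_add_vec[of _ N])
  hence "P1 *\<^sub>v q = 0\<^sub>v N" using P1c pc qc by (intro add_vec_eq_right_imp_zero) auto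
  hence "q = 0\<^sub>v N" using S2[OF qS] by simp
  thus "v = 0\<^sub>v N" using vpq p0 by simp
qed

section \<open>Counting eigenvalues\<close>

lemma comm_ring_hom_cnj: "comm_ring_hom cnj" by (unfold_locales, auto)

lemma det_adjoint:
  assumes X: "(X :: complex mat) \<in> carrier_mat N N"
  shows "det (mat_adjoint X) = cnj (det X)"
proof -
  have "mat_adjoint X = transpose_mat (map_mat cnj X)" using X by (intro eq_matI, auto)
  hence "det (mat_adjoint X) = det (map_mat cnj X)" using X by (simp add: det_transpose[of _ N])
  also have "\<dots> = cnj (det X)" by (rule comm_ring_hom.hom_det[OF comm_ring_hom_cnj])
  finally show ?thesis .
qed

lemma eigenvalue_adjoint_cnj:
  assumes H: "(H :: complex mat) \<in> carrier_mat N N" and e: "eigenvalue (mat_adjoint H) z"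
  shows "eigenvalue H (cnj z)"
proof -
  have aH: "mat_adjoint H \<in> carrier_mat N N" using H by auto
  have "char_matrix (mat_adjoint H) z = mat_adjoint (char_matrix H (cnj z))"
    unfolding char_matrix_def using H by (intro eq_matI, auto)
  hence "det (char_matrix (mat_adjoint H) z) = cnj (det (char_matrix H (cnj z)))"
    using det_adjoint[of "char_matrix H (cnj z)" N] H by auto
  thus ?thesis using e unfolding eigenvalue_det[OF aH] eigenvalue_det[OF H] by auto
qed

lemma order_prod_linear_factors: "order w (\<Prod>a\<leftarrow>as. [:- a, 1:]) = count_list as (w :: complex)"
proof (induct as)
  case Nil
  then show ?case by (simp add: order_0I)
next
  case (Cons a as)
  have nz: "(\<Prod>a\<leftarrow>as. [:- a, 1:]) \<noteq> (0 :: complex poly)"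
    by (subst prod_list_zero_iff, auto)
  have l0: "[:- a, 1:] \<noteq> (0 :: complex poly)" by simp
  have "[:- a, 1:] * (\<Prod>a\<leftarrow>as. [:- a, 1:]) \<noteq> 0" using nz l0 by (metis mult_eq_0_iff)
  hence "order w ([:- a, 1:] * (\<Prod>a\<leftarrow>as. [:- a, 1:])) = order w [:- a, 1:] + order w (\<Prod>a\<leftarrow>as. [:- a, 1:])"
    by (rule order_mult)
  moreover have "order w [:- a, 1:] = (if a = w then 1 else 0)" unfolding order_linear' by auto
  ultimately show ?case using Cons by simp
qed

lemma sum_count_list_filter: "(\<Sum>z \<in> {z. z \<in> set as \<and> P z}. count_list as z) = length (filter P as)"
proof -
  have "(\<Sum>z \<in> {z. z \<in> set as \<and> P z}. count_list as z)
      = (\<Sum>z \<in> {z. z \<in> set as \<and> P z}. count_list (filter P as) z)"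
    by (intro sum.cong, auto simp: count_list_eq_length_filter, metis filter_filter)
  also have "\<dots> = length (filter P as)" by (rule sum_count_set, auto)
  finally show ?thesis .
qed

lemma num_eigs_eq_length_filter: assumes H: "(H :: complex mat) \<in> carrier_mat N N"
  and cp: "char_poly H = (\<Prod>a\<leftarrow>as. [:- a, 1:])"
  shows "num_eigs H P = length (filter P as)"
proof -
  have ev: "\<And>z. eigenvalue H z \<longleftrightarrow> z \<in> set as"
    unfolding eigenvalue_root_char_poly[OF H] cp poly_prod_list_zero_iff by auto
  have "num_eigs H P = (\<Sum>z \<in> {z. z \<in> set as \<and> P z}. count_list as z)"
    unfolding num_eigs_def ev cp order_prod_linear_factors ..
  thus ?thesis using sum_count_list_filter by simp
qed

lemma no_imaginary_eigenvalue: assumes H: "(H :: complex mat) \<in> carrier_mat (n+n) (n+n)"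
  and neg: "num_eigs H (\<lambda>z. Re z < 0) = n" and pos: "num_eigs H (\<lambda>z. Re z > 0) = n"
  and e: "eigenvalue H w" shows "Re w \<noteq> 0"
proof -
  from char_poly_factorized[OF H] obtain as where cp: "char_poly H = (\<Prod>a\<leftarrow>as. [:- a, 1:])"
    and len: "length as = n + n" by auto
  have l1: "length (filter (\<lambda>z. Re z < 0) as) = n" using num_eigs_eq_length_filter[OF H cp] neg by simp
  have l2: "length (filter (\<lambda>z. Re z > 0) as) = n" using num_eigs_eq_length_filter[OF H cp] pos by simp
  let ?as = "filter (\<lambda>z. \<not> Re z < 0) as"
  have l3: "length ?as = n" using sum_length_filter_compl[of "\<lambda>z. Re z < 0" as] l1 len by simp
  have "filter (\<lambda>z. Re z > 0) ?as = filter (\<lambda>z. Re z > 0) as"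
    by (simp add: filter_filter, metis less_asym)
  hence "length (filter (\<lambda>z. \<not> Re z > 0) ?as) = 0"
    using sum_length_filter_compl[of "\<lambda>z. Re z > 0" ?as] l2 l3 by simp
  hence "\<forall>z\<in>set as. Re z \<noteq> 0" by (auto simp: filter_empty_conv)
  moreover have "w \<in> set as"
    using e unfolding eigenvalue_root_char_poly[OF H] cp poly_prod_list_zero_iff by auto
  ultimately show ?thesis by auto
qed

section \<open>Splitting along the imaginary axis\<close>

lemma vsum_in_lin_span:
  assumes "\<And>i. i \<in> set is \<Longrightarrow> b i \<in> carrier_vec N"
  shows "foldr (+) (map (\<lambda>i. c i \<cdot>\<^sub>v b i) is) (0\<^sub>v N) \<in> lin_span N (map b is)"
  using assms by (induct "is") auto

context
  fixes N :: nat and M :: "complex mat"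
  assumes M: "M \<in> carrier_mat N N"
    and no_imag: "\<And>z. eigenvalue M z \<Longrightarrow> Re z \<noteq> 0"
begin

lemma spectral_split_lin_span:
  "\<exists>L. set L \<subseteq> carrier_vec N \<and> set L \<subseteq> spectral_subspace N M (\<lambda>z. Re z < 0) \<and>
    (\<forall>v \<in> carrier_vec N.
      \<exists>vn vp. vn \<in> lin_span N L \<and> vp \<in> spectral_subspace N M (\<lambda>z. Re z > 0) \<and> v = vn + vp)"
proof -
  from gen_eigvec_basis_exists[OF M] obtain P Q lam where P: "P \<in> carrier_mat N N"
    and Q: "Q \<in> carrier_mat N N" and PQ: "P * Q = 1\<^sub>m N"
    and ge: "\<forall>i<N. gen_eigvec N M (lam i) (col P i)" by auto
  let ?p = "\<lambda>i. Re (lam i) < 0"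
  define L where "L = map (col P) (filter ?p [0..<N])"
  have Lc: "set L \<subseteq> carrier_vec N" unfolding L_def using P by auto
  have LD: "set L \<subseteq> spectral_subspace N M (\<lambda>z. Re z < 0)" unfolding L_def
    using ge by (auto intro!: spectral_subspace_gen_eigvec[OF M])
  have split: "\<exists>vn vp. vn \<in> lin_span N L \<and> vp \<in> spectral_subspace N M (\<lambda>z. Re z > 0) \<and> v = vn + vp"
    if v: "v \<in> carrier_vec N" for v
  proof -
    define w where "w = Q *\<^sub>v v"
    define part where "part I = foldr (+) (map (\<lambda>i. w $ i \<cdot>\<^sub>v col P i) I) (0\<^sub>v N)" for I
    have wc: "w \<in> carrier_vec N" unfolding w_def using Q v by auto
    have "v = P *\<^sub>v w"
      unfolding w_def using P Q v PQ by (simp add: assoc_mult_mat_vec[symmetric, of _ N N _ N])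
    also have "\<dots> = part [0..<N]" unfolding part_def by (rule mult_vec_eq_vsum_cols[OF P wc])
    also have "\<dots> = part (filter ?p [0..<N]) + part (filter (\<lambda>i. \<not> ?p i) [0..<N])"
      unfolding part_def by (rule vsum_filter_split, use P in auto)
    finally have vsplit: "v = \<dots>" .
    have vn: "part (filter ?p [0..<N]) \<in> lin_span N L"
      unfolding L_def part_def by (rule vsum_in_lin_span, use P in auto)
    have "w $ i \<cdot>\<^sub>v col P i \<in> spectral_subspace N M (\<lambda>z. Re z > 0)" if i: "i < N" "\<not> ?p i" for i
    proof (cases "w $ i \<cdot>\<^sub>v col P i = 0\<^sub>v N")
      case True
      thus ?thesis using spectral_subspace_zero[OF M] by simp
    next
      case False
      have g: "gen_eigvec N M (lam i) (w $ i \<cdot>\<^sub>v col P i)"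
        using gen_eigvec_smult[OF M, of "lam i" "col P i" "w $ i"] ge i by auto
      have "Re (lam i) > 0" using no_imag[OF gen_eigvec_eigenvalue[OF M g False]] i by auto
      thus ?thesis by (rule spectral_subspace_gen_eigvec[OF M _ g])
    qed
    hence "set (map (\<lambda>i. w $ i \<cdot>\<^sub>v col P i) (filter (\<lambda>i. \<not> ?p i) [0..<N]))
        \<subseteq> spectral_subspace N M (\<lambda>z. Re z > 0)" by auto
    hence "part (filter (\<lambda>i. \<not> ?p i) [0..<N]) \<in> spectral_subspace N M (\<lambda>z. Re z > 0)"
      unfolding part_def by (rule spectral_subspace_vsum[OF M])
    with vn vsplit show ?thesis by blast
  qed
  thus ?thesis using Lc LD by blast
qed

lemma spectral_subspace_decomp:
  assumes "v \<in> carrier_vec N"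
  shows "\<exists>vn vp. vn \<in> spectral_subspace N M (\<lambda>z. Re z < 0) \<and>
    vp \<in> spectral_subspace N M (\<lambda>z. Re z > 0) \<and> v = vn + vp"
proof -
  obtain L where Lc: "set L \<subseteq> carrier_vec N" and LD: "set L \<subseteq> spectral_subspace N M (\<lambda>z. Re z < 0)"
    and split: "\<forall>v \<in> carrier_vec N.
      \<exists>vn vp. vn \<in> lin_span N L \<and> vp \<in> spectral_subspace N M (\<lambda>z. Re z > 0) \<and> v = vn + vp"
    using spectral_split_lin_span by blast
  have "lin_span N L \<subseteq> spectral_subspace N M (\<lambda>z. Re z < 0)"
    by (rule lin_span_subset[OF Lc spectral_subspace_zero[OF M] spectral_subspace_add[OF M]
          spectral_subspace_smult[OF M] LD])
  thus ?thesis using split assms by blast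
qed

lemma spectral_subspace_neg_eq_lin_span:
  "\<exists>L. set L \<subseteq> carrier_vec N \<and> spectral_subspace N M (\<lambda>z. Re z < 0) = lin_span N L"
proof -
  let ?D = "spectral_subspace N M (\<lambda>z. Re z < 0)"
  let ?E = "spectral_subspace N M (\<lambda>z. Re z > 0)"
  obtain L where Lc: "set L \<subseteq> carrier_vec N" and LD: "set L \<subseteq> ?D"
    and split: "\<forall>v \<in> carrier_vec N. \<exists>vn vp. vn \<in> lin_span N L \<and> vp \<in> ?E \<and> v = vn + vp"
    using spectral_split_lin_span by blast
  have sub: "lin_span N L \<subseteq> ?D"
    by (rule lin_span_subset[OF Lc spectral_subspace_zero[OF M] spectral_subspace_add[OF M]
          spectral_subspace_smult[OF M] LD])
  have "d \<in> lin_span N L" if d: "d \<in> ?D" for d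
  proof -
    have dc: "d \<in> carrier_vec N" by (rule spectral_subspace_carrier[OF M d])
    from split dc obtain dn dp where dn: "dn \<in> lin_span N L" and dp: "dp \<in> ?E" and dd: "d = dn + dp"
      by auto
    have dnc: "dn \<in> carrier_vec N" using lin_span_carrier[OF Lc dn] .
    have dpc: "dp \<in> carrier_vec N" using spectral_subspace_carrier[OF M dp] .
    have "dp = d - dn" unfolding dd using dnc dpc by (intro eq_vecI, auto)
    hence "dp \<in> ?D" using spectral_subspace_diff[OF M d] sub dn by auto
    hence "dp = 0\<^sub>v N" by (rule spectral_subspaces_disjoint[OF M _ dp], auto)
    thus ?thesis using dd dn dnc by simp
  qed
  hence "?D = lin_span N L" using sub by blast
  thus ?thesis using Lc by blast
qed

end

section \<open>The symplectic form and Hamiltonian matrices\<close>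

definition symp_J :: "nat \<Rightarrow> complex mat" where
  "symp_J n = four_block_mat (0\<^sub>m n n) (1\<^sub>m n) (- 1\<^sub>m n) (0\<^sub>m n n)"

definition symp_form :: "nat \<Rightarrow> complex vec \<Rightarrow> complex vec \<Rightarrow> complex" where
  "symp_form n u w = cinner u (symp_J n *\<^sub>v w)"

lemma symp_J_carrier[simp]: "symp_J n \<in> carrier_mat (n+n) (n+n)"
  unfolding symp_J_def by auto

lemma symp_J_mult_vec_carrier[simp]: "w \<in> carrier_vec (n+n) \<Longrightarrow> symp_J n *\<^sub>v w \<in> carrier_vec (n+n)"
  by (rule mult_mat_vec_carrier[OF symp_J_carrier])

lemma symp_J_mult_append:
  assumes a: "(a :: complex vec) \<in> carrier_vec n" and b: "b \<in> carrier_vec n"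
  shows "symp_J n *\<^sub>v (a @\<^sub>v b) = b @\<^sub>v (- a)"
  unfolding symp_J_def
  using four_block_mat_mult_vec[OF zero_carrier_mat one_carrier_mat uminus_carrier_mat[OF one_carrier_mat]
      zero_carrier_mat a b] a b
  by (simp, intro eq_vecI, auto)

lemma carrier_vec_append_split:
  "(u :: complex vec) \<in> carrier_vec (n + m) \<Longrightarrow> \<exists>a b. a \<in> carrier_vec n \<and> b \<in> carrier_vec m \<and> u = a @\<^sub>v b"
  by (intro exI[of _ "vec_first u n"] exI[of _ "vec_last u m"], auto)

lemma vec_first_append[simp]: "(a :: complex vec) \<in> carrier_vec n \<Longrightarrow> vec_first (a @\<^sub>v b) n = a"
  by (intro eq_vecI, auto simp: vec_first_def)

lemma zero_vec_append: "0\<^sub>v (n + m) = (0\<^sub>v n @\<^sub>v 0\<^sub>v m :: complex vec)"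
  by (intro eq_vecI, auto)

lemma symp_form_zero_left[simp]: "symp_form n (0\<^sub>v m) w = 0"
  unfolding symp_form_def cinner_def by simp

lemma symp_form_zero_right[simp]: "u \<in> carrier_vec (n+n) \<Longrightarrow> symp_form n u (0\<^sub>v (n+n)) = 0"
  unfolding symp_form_def by (subst mult_mat_zero_vec[of _ "n+n" "n+n"], auto simp: cinner_zero_right)

lemma symp_form_add_left:
  "u1 \<in> carrier_vec (n+n) \<Longrightarrow> u2 \<in> carrier_vec (n+n) \<Longrightarrow> w \<in> carrier_vec (n+n) \<Longrightarrow>
    symp_form n (u1 + u2) w = symp_form n u1 w + symp_form n u2 w"
  unfolding symp_form_def by (rule cinner_add_left[of _ "n+n"], auto)

lemma symp_form_smult_left: "symp_form n (c \<cdot>\<^sub>v u) w = cnj c * symp_form n u w"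
  unfolding symp_form_def by (rule cinner_smult_left)

lemma symp_form_add_right:
  "u \<in> carrier_vec (n+n) \<Longrightarrow> w1 \<in> carrier_vec (n+n) \<Longrightarrow> w2 \<in> carrier_vec (n+n) \<Longrightarrow>
    symp_form n u (w1 + w2) = symp_form n u w1 + symp_form n u w2"
  unfolding symp_form_def
  by (subst mult_add_distrib_mat_vec[of _ "n+n" "n+n"], auto intro!: cinner_add_right[of _ "n+n"])

lemma symp_form_smult_right:
  "u \<in> carrier_vec (n+n) \<Longrightarrow> w \<in> carrier_vec (n+n) \<Longrightarrow> symp_form n u (c \<cdot>\<^sub>v w) = c * symp_form n u w"
  unfolding symp_form_def
  by (subst mult_mat_vec[of _ "n+n" "n+n"], auto intro!: cinner_smult_right[of _ "n+n"])

lemma symp_form_diff_right: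
  "u \<in> carrier_vec (n+n) \<Longrightarrow> w1 \<in> carrier_vec (n+n) \<Longrightarrow> w2 \<in> carrier_vec (n+n) \<Longrightarrow>
    symp_form n u (w1 - w2) = symp_form n u w1 - symp_form n u w2"
  unfolding symp_form_def
  by (subst mult_minus_distrib_mat_vec[of _ "n+n" "n+n"], auto intro!: cinner_diff_right[of _ "n+n"])

lemma symp_form_vsum_left:
  "set vs \<subseteq> carrier_vec (n+n) \<Longrightarrow> w \<in> carrier_vec (n+n) \<Longrightarrow>
    symp_form n (foldr (+) vs (0\<^sub>v (n+n))) w = (\<Sum>v\<leftarrow>vs. symp_form n v w)"
proof (induct vs)
  case Nil
  then show ?case by (simp add: symp_form_def cinner_def)
qed (simp add: symp_form_add_left vsum_carrier)

lemma symp_form_vsum_right: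
  "u \<in> carrier_vec (n+n) \<Longrightarrow> set ws \<subseteq> carrier_vec (n+n) \<Longrightarrow>
    symp_form n u (foldr (+) ws (0\<^sub>v (n+n))) = (\<Sum>w\<leftarrow>ws. symp_form n u w)"
proof (induct ws)
  case Nil
  then show ?case by simp
qed (simp add: symp_form_add_right vsum_carrier)

lemma symp_form_nondegenerate:
  assumes w: "w \<in> carrier_vec (n+n)" and orth: "\<And>v. v \<in> carrier_vec (n+n) \<Longrightarrow> symp_form n v w = 0"
  shows "w = 0\<^sub>v (n+n)"
proof -
  obtain a b where a: "a \<in> carrier_vec n" and b: "b \<in> carrier_vec n" and wab: "w = a @\<^sub>v b"
    using carrier_vec_append_split[OF w] by auto
  have Jw: "symp_J n *\<^sub>v w \<in> carrier_vec (n+n)" using w by auto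
  have "symp_J n *\<^sub>v w = 0\<^sub>v (n+n)"
    using cinner_self_eq_0[OF Jw] orth[OF Jw] unfolding symp_form_def .
  hence "b = 0\<^sub>v n \<and> - a = 0\<^sub>v n"
    unfolding wab symp_J_mult_append[OF a b] zero_vec_append using b by simp
  thus ?thesis unfolding wab zero_vec_append using a uminus_zero_vec_eq[OF a] by simp
qed

text \<open>For an \<open>\<omega>\<close>-skew \<open>M\<close> one has
  \<open>(cnj z + z') \<omega>(u, w) = -\<omega>((M - z) u, w) - \<omega>(u, (M - z') w)\<close>,
  so induction on the exponents that kill \<open>u\<close> and \<open>w\<close> gives \<open>\<omega>(u, w) = 0\<close>.\<close>

context
  fixes n :: nat and M :: "complex mat"
  assumes M: "M \<in> carrier_mat (n+n) (n+n)"
    and skew: "\<And>u w. u \<in> carrier_vec (n+n) \<Longrightarrow> w \<in> carrier_vec (n+n) \<Longrightarrow>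
      symp_form n (M *\<^sub>v u) w = - symp_form n u (M *\<^sub>v w)"
begin

lemma symp_form_shift_pow_kernels:
  "u \<in> carrier_vec (n+n) \<Longrightarrow> w \<in> carrier_vec (n+n) \<Longrightarrow>
    ((M - z \<cdot>\<^sub>m 1\<^sub>m (n+n)) ^\<^sub>m k) *\<^sub>v u = 0\<^sub>v (n+n) \<Longrightarrow>
    ((M - z' \<cdot>\<^sub>m 1\<^sub>m (n+n)) ^\<^sub>m k') *\<^sub>v w = 0\<^sub>v (n+n) \<Longrightarrow> cnj z + z' \<noteq> 0 \<Longrightarrow> symp_form n u w = 0"
proof (induct k arbitrary: u k' w)
  case 0
  then show ?case by simp
next
  case (Suc k)
  note IH_k = Suc(1)
  show ?case using Suc(2-)
  proof (induct k' arbitrary: w)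
    case 0
    then show ?case by simp
  next
    case (Suc k')
    let ?T = "M - z \<cdot>\<^sub>m 1\<^sub>m (n+n)" let ?T' = "M - z' \<cdot>\<^sub>m 1\<^sub>m (n+n)"
    have T: "?T \<in> carrier_mat (n+n) (n+n)" "?T' \<in> carrier_mat (n+n) (n+n)" using M by auto
    have u: "u \<in> carrier_vec (n+n)" and w: "w \<in> carrier_vec (n+n)" using Suc by auto
    define u' where "u' = ?T *\<^sub>v u"
    define w' where "w' = ?T' *\<^sub>v w"
    have u'c: "u' \<in> carrier_vec (n+n)" "w' \<in> carrier_vec (n+n)"
      unfolding u'_def w'_def using T u w by auto
    have "((?T ^\<^sub>m k) * ?T) *\<^sub>v u = 0\<^sub>v (n+n)" using Suc(4) by simp
    hence ku: "(?T ^\<^sub>m k) *\<^sub>v u' = 0\<^sub>v (n+n)" unfolding u'_def using T u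
      by (simp add: assoc_mult_mat_vec[of _ "n+n" "n+n" _ "n+n"])
    have "((?T' ^\<^sub>m k') * ?T') *\<^sub>v w = 0\<^sub>v (n+n)" using Suc(5) by simp
    hence kw: "(?T' ^\<^sub>m k') *\<^sub>v w' = 0\<^sub>v (n+n)" unfolding w'_def using T w
      by (simp add: assoc_mult_mat_vec[of _ "n+n" "n+n" _ "n+n"])
    have o1: "symp_form n u' w = 0" by (rule IH_k[OF u'c(1) w ku Suc(5) Suc(6)])
    have o2: "symp_form n u w' = 0" by (rule Suc(1)[OF u u'c(2) Suc(4) kw Suc(6)])
    have Mu: "M *\<^sub>v u = z \<cdot>\<^sub>v u + u'" unfolding u'_def shift_mult_vec[OF M u] using M u
      by (intro eq_vecI, auto)
    have Mw: "M *\<^sub>v w = z' \<cdot>\<^sub>v w + w'" unfolding w'_def shift_mult_vec[OF M w] using M w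
      by (intro eq_vecI, auto)
    have "symp_form n (M *\<^sub>v u) w = cnj z * symp_form n u w" unfolding Mu
      using u w u'c by (simp add: symp_form_add_left symp_form_smult_left o1)
    moreover have "symp_form n u (M *\<^sub>v w) = z' * symp_form n u w" unfolding Mw
      using u w u'c by (simp add: symp_form_add_right symp_form_smult_right o2)
    ultimately have "cnj z * symp_form n u w = - (z' * symp_form n u w)" using skew[OF u w] by simp
    hence "(cnj z + z') * symp_form n u w = 0" by (simp add: algebra_simps)
    thus ?case using Suc(6) by simp
  qed
qed

lemma symp_form_spectral_subspaces:
  assumes x: "x \<in> spectral_subspace (n+n) M P" and y: "y \<in> spectral_subspace (n+n) M P'"
    and nz: "\<And>z z'. P z \<Longrightarrow> P' z' \<Longrightarrow> cnj z + z' \<noteq> 0"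
  shows "symp_form n x y = 0"
proof -
  from x obtain vs
    where vs: "\<forall>v \<in> set vs. \<exists>z. P z \<and> gen_eigvec (n+n) M z v" "x = foldr (+) vs (0\<^sub>v (n+n))"
    unfolding spectral_subspace_def by auto
  from y obtain ws
    where ws: "\<forall>w \<in> set ws. \<exists>z. P' z \<and> gen_eigvec (n+n) M z w" "y = foldr (+) ws (0\<^sub>v (n+n))"
    unfolding spectral_subspace_def by auto
  have vsc: "set vs \<subseteq> carrier_vec (n+n)" and wsc: "set ws \<subseteq> carrier_vec (n+n)"
    using vs(1) ws(1) unfolding gen_eigvec_def by auto
  have "symp_form n v w = 0" if v: "v \<in> set vs" and w: "w \<in> set ws" for v w
  proof -
    obtain z k where "P z" "v \<in> carrier_vec (n+n)" "((M - z \<cdot>\<^sub>m 1\<^sub>m (n+n)) ^\<^sub>m k) *\<^sub>v v = 0\<^sub>v (n+n)"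
      using vs(1) v unfolding gen_eigvec_def by blast
    moreover obtain z' k' where "P' z'" "w \<in> carrier_vec (n+n)"
      "((M - z' \<cdot>\<^sub>m 1\<^sub>m (n+n)) ^\<^sub>m k') *\<^sub>v w = 0\<^sub>v (n+n)"
      using ws(1) w unfolding gen_eigvec_def by blast
    ultimately show ?thesis using symp_form_shift_pow_kernels nz by blast
  qed
  hence "symp_form n v y = 0" if "v \<in> set vs" for v
    using that vsc wsc unfolding ws(2) by (subst symp_form_vsum_right) (auto intro!: sum_list_neutral)
  thus ?thesis
    using vsc spectral_subspace_carrier[OF M y] unfolding vs(2)
    by (subst symp_form_vsum_left) (auto intro!: sum_list_neutral)
qed

end

lemma hamiltonian_carrier:
  "A \<in> carrier_mat n n \<Longrightarrow> F \<in> carrier_mat n n \<Longrightarrow> G \<in> carrier_mat n n \<Longrightarrow>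
    hamiltonian A F G \<in> carrier_mat (n+n) (n+n)"
  unfolding hamiltonian_def by auto

context
  fixes n :: nat and A F G :: "complex mat"
  assumes A: "A \<in> carrier_mat n n" and F: "hermitian_mat n F" and G: "hermitian_mat n G"
begin

lemma hermitian_carriers: "F \<in> carrier_mat n n" "G \<in> carrier_mat n n"
  using F G unfolding hermitian_mat_def by auto

lemma adjoint_hamiltonian:
  "mat_adjoint (hamiltonian A F G) = four_block_mat (mat_adjoint A) (- G) (- F) (- A)"
  unfolding hamiltonian_def using A F G hermitian_carriers unfolding hermitian_mat_def
  by (subst adjoint_four_block[of _ n n _ n _ n], auto simp: adjoint_uminus)

lemma adjoint_hamiltonian_mult_append:
  assumes a: "a \<in> carrier_vec n" and b: "b \<in> carrier_vec n"
  shows "mat_adjoint (hamiltonian A F G) *\<^sub>v (a @\<^sub>v b) =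
    (mat_adjoint A *\<^sub>v a - G *\<^sub>v b) @\<^sub>v (- (F *\<^sub>v a) - A *\<^sub>v b)"
  unfolding adjoint_hamiltonian using A hermitian_carriers a b
  by (subst four_block_mat_mult_vec[of _ n n], auto intro!: eq_vecI)

lemma hamiltonian_mult_append:
  assumes a: "a \<in> carrier_vec n" and b: "b \<in> carrier_vec n"
  shows "hamiltonian A F G *\<^sub>v (a @\<^sub>v b) = (A *\<^sub>v a - F *\<^sub>v b) @\<^sub>v (- (G *\<^sub>v a) - mat_adjoint A *\<^sub>v b)"
  unfolding hamiltonian_def using A hermitian_carriers a b
  by (subst four_block_mat_mult_vec[of _ n n], auto intro!: eq_vecI)

text \<open>Equivalently, \<open>J \<H>\<close> is Hermitian; this is where \<open>F\<^sup>* = F\<close> and \<open>G\<^sup>* = G\<close> enter.\<close>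

lemma hamiltonian_mult_symp_J:
  assumes w: "w \<in> carrier_vec (n+n)"
  shows "hamiltonian A F G *\<^sub>v (symp_J n *\<^sub>v w) = - (symp_J n *\<^sub>v (mat_adjoint (hamiltonian A F G) *\<^sub>v w))"
proof -
  obtain c d where c: "c \<in> carrier_vec n" and d: "d \<in> carrier_vec n" and wcd: "w = c @\<^sub>v d"
    using carrier_vec_append_split[OF w] by auto
  have Ac: "mat_adjoint A \<in> carrier_mat n n" using A by (rule adjoint_carrier)
  note carriers = A Ac hermitian_carriers c d
    mult_mat_vec_carrier[OF Ac c] mult_mat_vec_carrier[OF A d]
    mult_mat_vec_carrier[OF hermitian_carriers(1) c] mult_mat_vec_carrier[OF hermitian_carriers(2) d]
  have "hamiltonian A F G *\<^sub>v (symp_J n *\<^sub>v w)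
      = (A *\<^sub>v d - F *\<^sub>v (- c)) @\<^sub>v (- (G *\<^sub>v d) - mat_adjoint A *\<^sub>v (- c))"
    unfolding wcd symp_J_mult_append[OF c d] using c by (intro hamiltonian_mult_append[OF d]) auto
  also have "\<dots> = - ((- (F *\<^sub>v c) - A *\<^sub>v d) @\<^sub>v (- (mat_adjoint A *\<^sub>v c - G *\<^sub>v d)))"
    using carriers by (intro eq_vecI) auto
  also have "\<dots> = - (symp_J n *\<^sub>v (mat_adjoint (hamiltonian A F G) *\<^sub>v w))"
    unfolding wcd adjoint_hamiltonian_mult_append[OF c d] using carriers
    by (subst symp_J_mult_append) auto
  finally show ?thesis .
qed

lemma symp_form_adjoint_hamiltonian_skew:
  assumes u: "u \<in> carrier_vec (n+n)" and w: "w \<in> carrier_vec (n+n)"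
  shows "symp_form n (mat_adjoint (hamiltonian A F G) *\<^sub>v u) w
    = - symp_form n u (mat_adjoint (hamiltonian A F G) *\<^sub>v w)"
proof -
  let ?H = "hamiltonian A F G"
  have H: "?H \<in> carrier_mat (n+n) (n+n)" using hamiltonian_carrier A hermitian_carriers by blast
  have "symp_form n (mat_adjoint ?H *\<^sub>v u) w = cinner u (?H *\<^sub>v (symp_J n *\<^sub>v w))"
    unfolding symp_form_def using cinner_adjoint[OF H u, of "symp_J n *\<^sub>v w"] w by simp
  also have "\<dots> = - symp_form n u (mat_adjoint ?H *\<^sub>v w)"
    unfolding hamiltonian_mult_symp_J[OF w] symp_form_def
    using u w mult_mat_vec_carrier[OF adjoint_carrier[OF H] w]
    by (subst cinner_uminus_right[of _ "n+n"], auto)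
  finally show ?thesis .
qed

end

section \<open>Positive semidefinite matrices\<close>

lemma linear_dominated_by_quadratic:
  fixes s r :: real
  assumes nonneg: "\<And>t. 0 \<le> 2 * t * s + t\<^sup>2 * r" and r: "0 \<le> r"
  shows "s = 0"
proof -
  define q where "q = r + 1"
  have q: "0 < q" using r unfolding q_def by simp
  have "0 \<le> (2 * (- s / q) * s + (- s / q)\<^sup>2 * r) * q\<^sup>2" using nonneg[of "- s / q"] by simp
  also have "\<dots> = s\<^sup>2 * (r - 2 * q)"
    using q by (simp add: power2_eq_square field_simps)
  also have "\<dots> = - s\<^sup>2 * (r + 2)" unfolding q_def by (simp add: algebra_simps)
  finally show ?thesis using r by (simp add: mult_le_0_iff)
qed

lemma psd_cinner_nonneg: "psd_mat n G \<Longrightarrow> v \<in> carrier_vec n \<Longrightarrow> 0 \<le> Re (cinner v (G *\<^sub>v v))"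
  unfolding psd_mat_def hermitian_mat_def by (auto simp: cscalar_prod_eq_cinner)

lemma psd_quadratic_form_eq_0:
  assumes G: "psd_mat n G" and y: "y \<in> carrier_vec n" and e: "cinner y (G *\<^sub>v y) = 0"
  shows "G *\<^sub>v y = 0\<^sub>v n"
proof -
  have Gh: "hermitian_mat n G" using G unfolding psd_mat_def by auto
  hence Gc: "G \<in> carrier_mat n n" unfolding hermitian_mat_def by auto
  define g where "g = G *\<^sub>v y"
  have gc: "g \<in> carrier_vec n" and Ggc: "G *\<^sub>v g \<in> carrier_vec n" unfolding g_def using Gc y by auto
  have yGg: "cinner y (G *\<^sub>v g) = cinner g g" using cinner_hermitian[OF Gh y gc] unfolding g_def .
  have "0 \<le> 2 * t * Re (cinner g g) + t\<^sup>2 * Re (cinner g (G *\<^sub>v g))" for t :: real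
  proof -
    let ?t = "complex_of_real t"
    have vc: "y + ?t \<cdot>\<^sub>v g \<in> carrier_vec n" using y gc by auto
    have Gv: "G *\<^sub>v (y + ?t \<cdot>\<^sub>v g) = g + ?t \<cdot>\<^sub>v (G *\<^sub>v g)"
      unfolding g_def using Gc y gc
      by (simp add: mult_add_distrib_mat_vec[of _ n n] mult_mat_vec[of _ n n])
    have "cinner (y + ?t \<cdot>\<^sub>v g) (G *\<^sub>v (y + ?t \<cdot>\<^sub>v g))
        = cinner y g + ?t * cinner y (G *\<^sub>v g) + cnj ?t * cinner g g + cnj ?t * ?t * cinner g (G *\<^sub>v g)"
      unfolding Gv using y gc Ggc
      by (simp add: cinner_add_left[of _ n] cinner_add_right[of _ n] cinner_smult_left
          cinner_smult_right[of _ n] algebra_simps)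
    also have "\<dots> = 2 * ?t * cinner g g + ?t\<^sup>2 * cinner g (G *\<^sub>v g)"
      unfolding yGg using e unfolding g_def by (simp add: power2_eq_square)
    finally show ?thesis using psd_cinner_nonneg[OF G vc] by simp
  qed
  hence "Re (cinner g g) = 0"
    using linear_dominated_by_quadratic psd_cinner_nonneg[OF G gc] by blast
  hence "cinner g g = 0" using Im_cinner_self[of g] by (simp add: complex_eq_iff)
  thus ?thesis using cinner_self_eq_0[OF gc] unfolding g_def by simp
qed

section \<open>The stable invariant subspace of \<open>\<H>\<^sup>*\<close>\<close>

locale stable_psd_hamiltonian =
  fixes n :: nat and A F G :: "complex mat"
  assumes A: "A \<in> carrier_mat n n" and F: "psd_mat n F" and G: "psd_mat n G" and stable: "stable_mat A"
begin

abbreviation M :: "complex mat" where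
  "M \<equiv> mat_adjoint (hamiltonian A F G)"

abbreviation D :: "complex vec set" where
  "D \<equiv> spectral_subspace (n+n) M (\<lambda>z. Re z < 0)"

abbreviation E :: "complex vec set" where
  "E \<equiv> spectral_subspace (n+n) M (\<lambda>z. Re z > 0)"

lemma hermitian: "hermitian_mat n F" "hermitian_mat n G"
  using F G unfolding psd_mat_def by auto

lemma carriers: "F \<in> carrier_mat n n" "G \<in> carrier_mat n n"
  using hermitian unfolding hermitian_mat_def by auto

lemma M_carrier: "M \<in> carrier_mat (n+n) (n+n)"
  using hamiltonian_carrier[OF A carriers] by auto

lemma M_skew:
  "u \<in> carrier_vec (n+n) \<Longrightarrow> w \<in> carrier_vec (n+n) \<Longrightarrow> symp_form n (M *\<^sub>v u) w = - symp_form n u (M *\<^sub>v w)"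
  by (rule symp_form_adjoint_hamiltonian_skew[OF A hermitian])

lemma D_isotropic: assumes "x \<in> D" "y \<in> D" shows "symp_form n x y = 0"
  by (rule symp_form_spectral_subspaces[OF M_carrier M_skew assms]) (auto simp: complex_eq_iff)

lemma E_isotropic: assumes "x \<in> E" "y \<in> E" shows "symp_form n x y = 0"
  by (rule symp_form_spectral_subspaces[OF M_carrier M_skew assms]) (auto simp: complex_eq_iff)

lemma M_mult_bottom: "y \<in> carrier_vec n \<Longrightarrow> M *\<^sub>v (0\<^sub>v n @\<^sub>v y) = (- (G *\<^sub>v y)) @\<^sub>v (- (A *\<^sub>v y))"
  using A carriers by (subst adjoint_hamiltonian_mult_append[OF A hermitian], auto intro!: eq_vecI)

lemma symp_form_bottom:
  assumes y: "y \<in> carrier_vec n"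
  shows "symp_form n (0\<^sub>v n @\<^sub>v y) (M *\<^sub>v (0\<^sub>v n @\<^sub>v y)) = cinner y (G *\<^sub>v y)"
proof -
  have "G *\<^sub>v y \<in> carrier_vec n" "A *\<^sub>v y \<in> carrier_vec n" using y A carriers by auto
  thus ?thesis unfolding symp_form_def M_mult_bottom[OF y] using y
    by (subst symp_J_mult_append[of _ n], auto, subst cinner_append[of _ n],
        auto simp: cinner_uminus_right[of _ n])
qed

text \<open>By isotropy of \<open>D\<close> and \<open>G \<succeq> 0\<close>, \<open>M\<close> acts on the vectors \<open>(0, y) \<in> D\<close> as \<open>-A\<close>.\<close>

lemma D_bottom_mult:
  assumes y: "y \<in> carrier_vec n" and d: "0\<^sub>v n @\<^sub>v y \<in> D"
  shows "M *\<^sub>v (0\<^sub>v n @\<^sub>v y) = 0\<^sub>v n @\<^sub>v (- (A *\<^sub>v y))"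
proof -
  have "cinner y (G *\<^sub>v y) = 0"
    using D_isotropic[OF d spectral_subspace_mult[OF M_carrier d]] symp_form_bottom[OF y] by simp
  hence "G *\<^sub>v y = 0\<^sub>v n" by (rule psd_quadratic_form_eq_0[OF G y])
  thus ?thesis unfolding M_mult_bottom[OF y] by simp
qed

lemma D_bottom_shift:
  assumes y: "y \<in> carrier_vec n" and d: "0\<^sub>v n @\<^sub>v y \<in> D"
  shows "(M - c \<cdot>\<^sub>m 1\<^sub>m (n+n)) *\<^sub>v (0\<^sub>v n @\<^sub>v y) = 0\<^sub>v n @\<^sub>v (- (A *\<^sub>v y) - c \<cdot>\<^sub>v y)"
proof -
  have "(M - c \<cdot>\<^sub>m 1\<^sub>m (n+n)) *\<^sub>v (0\<^sub>v n @\<^sub>v y) = M *\<^sub>v (0\<^sub>v n @\<^sub>v y) - c \<cdot>\<^sub>v (0\<^sub>v n @\<^sub>v y)"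
    by (rule shift_mult_vec[OF M_carrier spectral_subspace_carrier[OF M_carrier d]])
  also have "\<dots> = (0\<^sub>v n @\<^sub>v (- (A *\<^sub>v y))) - c \<cdot>\<^sub>v (0\<^sub>v n @\<^sub>v y)"
    unfolding D_bottom_mult[OF y d] ..
  also have "\<dots> = 0\<^sub>v n @\<^sub>v (- (A *\<^sub>v y) - c \<cdot>\<^sub>v y)"
    using A y by (intro eq_vecI) (auto simp: carrier_matD)
  finally show ?thesis .
qed

lemma D_meets_bottom_trivially:
  assumes d: "d \<in> D" and d0: "vec_first d n = 0\<^sub>v n"
  shows "d = 0\<^sub>v (n+n)"
proof (rule ccontr)
  assume dn0: "d \<noteq> 0\<^sub>v (n+n)"
  let ?K = "{0\<^sub>v n @\<^sub>v y | y. y \<in> carrier_vec n \<and> 0\<^sub>v n @\<^sub>v y \<in> D}"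
  have "d = 0\<^sub>v n @\<^sub>v vec_last d n"
    using vec_first_last_append[of d n n] spectral_subspace_carrier[OF M_carrier d] d0 by simp
  hence dK: "d \<in> ?K" using d by (intro CollectI exI[of _ "vec_last d n"]) auto
  have K_shift: "(M - c \<cdot>\<^sub>m 1\<^sub>m (n+n)) *\<^sub>v x \<in> ?K" if "x \<in> ?K" for c x
  proof -
    from that obtain y where y: "y \<in> carrier_vec n" and x: "x = 0\<^sub>v n @\<^sub>v y" and xD: "x \<in> D" by auto
    have "(M - c \<cdot>\<^sub>m 1\<^sub>m (n+n)) *\<^sub>v x = 0\<^sub>v n @\<^sub>v (- (A *\<^sub>v y) - c \<cdot>\<^sub>v y)"
      unfolding x by (rule D_bottom_shift[OF y xD[unfolded x]])
    moreover have "(M - c \<cdot>\<^sub>m 1\<^sub>m (n+n)) *\<^sub>v x \<in> D" by (rule spectral_subspace_shift[OF M_carrier xD])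
    ultimately show ?thesis using A y by auto
  qed
  from spectral_subspace_annihilated[OF M_carrier d] obtain cs
    where cs: "\<forall>c\<in>set cs. Re c < 0" "shift_prod (n+n) M cs *\<^sub>v d = 0\<^sub>v (n+n)" by auto
  have "\<exists>c\<in>set cs. \<exists>w\<in>?K. w \<noteq> 0\<^sub>v (n+n) \<and> M *\<^sub>v w = c \<cdot>\<^sub>v w"
    by (rule invariant_subspace_eigenvector[OF M_carrier _ K_shift dK dn0 cs(2)]) auto
  then obtain c y where c: "Re c < 0" and y: "y \<in> carrier_vec n" and yD: "0\<^sub>v n @\<^sub>v y \<in> D"
    and y0: "0\<^sub>v n @\<^sub>v y \<noteq> 0\<^sub>v (n+n)" and My: "M *\<^sub>v (0\<^sub>v n @\<^sub>v y) = c \<cdot>\<^sub>v (0\<^sub>v n @\<^sub>v y)"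
    using cs by auto
  have "c \<cdot>\<^sub>v (0\<^sub>v n @\<^sub>v y) = 0\<^sub>v n @\<^sub>v (c \<cdot>\<^sub>v y)" using y by (intro eq_vecI) auto
  hence "0\<^sub>v n @\<^sub>v (- (A *\<^sub>v y)) = 0\<^sub>v n @\<^sub>v (c \<cdot>\<^sub>v y)" using My unfolding D_bottom_mult[OF y yD] by simp
  hence "- (A *\<^sub>v y) = c \<cdot>\<^sub>v y" by (simp add: append_vec_eq[of "0\<^sub>v n" n "0\<^sub>v n"])
  hence "A *\<^sub>v y = - (c \<cdot>\<^sub>v y)" by (metis uminus_uminus_vec)
  also have "- (c \<cdot>\<^sub>v y) = (- c) \<cdot>\<^sub>v y" by (intro eq_vecI) auto
  finally have "A *\<^sub>v y = (- c) \<cdot>\<^sub>v y" .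
  moreover have "y \<noteq> 0\<^sub>v n" using y0 zero_vec_append[of n n] by auto
  ultimately have "eigenvalue A (- c)" unfolding eigenvalue_def eigenvector_def using A y by auto
  thus False using stable c unfolding stable_mat_def by fastforce
qed

text \<open>The \<open>E\<close>-component \<open>e\<close> of \<open>(0, x)\<close> is \<open>\<omega>\<close>-orthogonal to everything, because
  \<open>J (0, x) = (x, 0) \<perp> D\<close>.\<close>

lemma D_perp_meets_top_trivially:
  assumes no_imag: "\<And>z. eigenvalue M z \<Longrightarrow> Re z \<noteq> 0"
    and x: "x \<in> carrier_vec n" and orth: "\<And>d. d \<in> D \<Longrightarrow> cinner d (x @\<^sub>v 0\<^sub>v n) = 0"
  shows "x = 0\<^sub>v n"
proof -
  define z where "z = 0\<^sub>v n @\<^sub>v x"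
  have zc: "z \<in> carrier_vec (n+n)" unfolding z_def using x by auto
  have Jz: "symp_J n *\<^sub>v z = x @\<^sub>v 0\<^sub>v n"
    unfolding z_def using x by (subst symp_J_mult_append[of _ n], auto)
  obtain zn zp where zn: "zn \<in> D" and zp: "zp \<in> E" and zz: "z = zn + zp"
    using spectral_subspace_decomp[OF M_carrier no_imag zc] by auto
  have znc: "zn \<in> carrier_vec (n+n)" and zpc: "zp \<in> carrier_vec (n+n)"
    using spectral_subspace_carrier[OF M_carrier] zn zp by auto
  have "symp_form n v zp = 0" if v: "v \<in> carrier_vec (n+n)" for v
  proof -
    obtain vn vp where vn: "vn \<in> D" and vp: "vp \<in> E" and vv: "v = vn + vp"
      using spectral_subspace_decomp[OF M_carrier no_imag v] by auto
    have vnc: "vn \<in> carrier_vec (n+n)" and vpc: "vp \<in> carrier_vec (n+n)"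
      using spectral_subspace_carrier[OF M_carrier] vn vp by auto
    have "zp = z - zn" unfolding zz using znc zpc by (intro eq_vecI, auto)
    hence "symp_form n vn zp = symp_form n vn z - symp_form n vn zn"
      using symp_form_diff_right[OF vnc zc znc] by simp
    also have "\<dots> = 0" using orth[OF vn] D_isotropic[OF vn zn] unfolding symp_form_def Jz by simp
    finally show ?thesis
      using E_isotropic[OF vp zp] unfolding vv by (simp add: symp_form_add_left vnc vpc zpc)
  qed
  hence "zp = 0\<^sub>v (n+n)" by (rule symp_form_nondegenerate[OF zpc])
  hence "z \<in> D" using zz zn znc by simp
  moreover have "vec_first z n = 0\<^sub>v n" unfolding z_def by simp
  ultimately have "z = 0\<^sub>v (n+n)" by (rule D_meets_bottom_trivially)
  thus ?thesis unfolding z_def zero_vec_append[of n n]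
    using append_vec_eq[of "0\<^sub>v n" n "0\<^sub>v n" x "0\<^sub>v n"] by simp
qed

end

section \<open>The projector onto \<open>Range [I; 0]\<close>\<close>

definition top_proj :: "nat \<Rightarrow> complex mat" where
  "top_proj n = mat (n+n) (n+n) (\<lambda>(i,j). if i = j \<and> i < n then 1 else 0)"

lemma top_proj_carrier: "top_proj n \<in> carrier_mat (n+n) (n+n)"
  unfolding top_proj_def by auto

lemma top_proj_mult_vec:
  "v \<in> carrier_vec (n+n) \<Longrightarrow> top_proj n *\<^sub>v v = vec_first v n @\<^sub>v 0\<^sub>v n"
  unfolding top_proj_def
  by (intro eq_vecI, auto simp: scalar_prod_def vec_first_def if_distrib if_distribR cong: if_cong)

lemma top_proj_mult_vec_eq_0:
  assumes "v \<in> carrier_vec (n+n)"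
  shows "top_proj n *\<^sub>v v = 0\<^sub>v (n+n) \<longleftrightarrow> vec_first v n = 0\<^sub>v n"
  unfolding top_proj_mult_vec[OF assms] zero_vec_append
  using append_vec_eq[of "vec_first v n" n "0\<^sub>v n" "0\<^sub>v n" "0\<^sub>v n"] by simp

lemma top_id_mult_vec: "x \<in> carrier_vec n \<Longrightarrow> top_id n *\<^sub>v x = x @\<^sub>v 0\<^sub>v n"
  unfolding top_id_def
  by (intro eq_vecI, auto simp: scalar_prod_def if_distrib if_distribR cong: if_cong)

lemma mat_range_top_id: "mat_range (top_id n) = {x @\<^sub>v 0\<^sub>v n | x. x \<in> carrier_vec n}"
proof -
  have dim: "dim_col (top_id n) = n" unfolding top_id_def by simp
  show ?thesis
  proof (intro equalityI subsetI)
    fix w :: "complex vec" assume "w \<in> mat_range (top_id n)"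
    thus "w \<in> {x @\<^sub>v 0\<^sub>v n | x. x \<in> carrier_vec n}"
      unfolding mat_range_def dim using top_id_mult_vec by auto
  next
    fix w :: "complex vec" assume "w \<in> {x @\<^sub>v 0\<^sub>v n | x. x \<in> carrier_vec n}"
    then obtain x where x: "x \<in> carrier_vec n" and w: "w = x @\<^sub>v 0\<^sub>v n" by auto
    show "w \<in> mat_range (top_id n)"
      unfolding mat_range_def dim w using x top_id_mult_vec[OF x, symmetric] by blast
  qed
qed

lemma top_proj_is_orth_proj: "is_orth_proj (n+n) (mat_range (top_id n)) (top_proj n)"
proof -
  have c: "top_proj n \<in> carrier_mat (n+n) (n+n)" by (rule top_proj_carrier)
  have "top_proj n * top_proj n = top_proj n"
    by (rule mat_eq_by_mult_vec[of _ "n+n"])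
      (use c in \<open>auto simp: assoc_mult_mat_vec[of _ "n+n" "n+n" _ "n+n"] top_proj_mult_vec\<close>)
  moreover have "mat_adjoint (top_proj n) = top_proj n" unfolding top_proj_def by (intro eq_matI, auto)
  moreover have "mat_range (top_proj n) = mat_range (top_id n)"
  proof (unfold mat_range_top_id, intro equalityI subsetI)
    fix w assume "w \<in> mat_range (top_proj n)"
    thus "w \<in> {x @\<^sub>v 0\<^sub>v n | x. x \<in> carrier_vec n}"
      unfolding mat_range_def using c top_proj_mult_vec by auto
  next
    fix w :: "complex vec" assume "w \<in> {x @\<^sub>v 0\<^sub>v n | x. x \<in> carrier_vec n}"
    then obtain x where x: "x \<in> carrier_vec n" and w: "w = x @\<^sub>v 0\<^sub>v n" by auto
    have wc: "w \<in> carrier_vec (n+n)" using x w by auto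
    have "w = top_proj n *\<^sub>v w" unfolding w using x by (subst top_proj_mult_vec) auto
    thus "w \<in> mat_range (top_proj n)" by (rule ssubst) (rule mat_range_memI[OF c wc])
  qed
  ultimately show ?thesis unfolding is_orth_proj_def using c by auto
qed

theorem proposition4p2:
  fixes n :: nat and A F G :: "complex mat"
  assumes A: "A \<in> carrier_mat n n"
    and F: "psd_mat n F"
    and G: "psd_mat n G"
    and standing_neg: "num_eigs (hamiltonian A F G) (\<lambda>z. Re z < 0) = n"
    and standing_pos: "num_eigs (hamiltonian A F G) (\<lambda>z. Re z > 0) = n"
    and stable: "stable_mat A"
  shows "subspace_dist (2 * n) (D_neg (2 * n) (mat_adjoint (hamiltonian A F G)))
           (mat_range (top_id n)) < 1"
proof -
  interpret stable_psd_hamiltonian n A F G using A F G stable by unfold_locales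
  have H: "hamiltonian A F G \<in> carrier_mat (n+n) (n+n)" by (rule hamiltonian_carrier[OF A carriers])
  have no_imag: "Re z \<noteq> 0" if "eigenvalue M z" for z
    using no_imaginary_eigenvalue[OF H standing_neg standing_pos eigenvalue_adjoint_cnj[OF H that]] by simp
  obtain L where "set L \<subseteq> carrier_vec (n+n)" and DL: "D = lin_span (n+n) L"
    using spectral_subspace_neg_eq_lin_span[OF M_carrier no_imag] by blast
  then obtain P where P: "is_orth_proj (n+n) D P" using orth_proj_lin_span_exists by metis
  have "spec_norm (P - top_proj n) < 1"
  proof (rule spec_norm_orth_proj_diff_lt_1[OF P top_proj_is_orth_proj])
    show "x = 0\<^sub>v (n+n)" if "x \<in> D" and "top_proj n *\<^sub>v x = 0\<^sub>v (n+n)" for x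
      using that D_meets_bottom_trivially top_proj_mult_vec_eq_0 spectral_subspace_carrier[OF M_carrier]
      by blast
    show "y = 0\<^sub>v (n+n)" if y: "y \<in> mat_range (top_id n)" and Py: "P *\<^sub>v y = 0\<^sub>v (n+n)" for y
    proof -
      obtain x where x: "x \<in> carrier_vec n" and yx: "y = x @\<^sub>v 0\<^sub>v n"
        using y unfolding mat_range_top_id by auto
      have "x = 0\<^sub>v n"
        using D_perp_meets_top_trivially[OF no_imag x] orth_proj_kernel_orthogonal[OF P _ _ Py] x yx
        by auto
      thus ?thesis unfolding yx zero_vec_append by simp
    qed
  qed
  thus ?thesis
    unfolding subspace_dist_def D_neg_def mult_2 orth_proj_eqI[OF P]
      orth_proj_eqI[OF top_proj_is_orth_proj] .
qed

end
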